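(* Let $T$ be a proper tree whose weighted skeleton is multiplicity-isolated, and let $T'$ be any proper tree. Then $$\Phi_T=\Phi_{T'}\implies T\cong T'.$$
   Context: All graphs are finite, simple and undirected. For a graph $G=(V,E)$, the chromatic symmetric function is $X_G=\sum_{\kappa}\prod_{v\in V}x_{\kappa(v)}$, the sum over all proper colorings $\kappa\colon V\to\{1,2,3,\dots\}$ (i.e. $\kappa(u)\neq\kappa(v)$ whenever $uv\in E$), where $x_1,x_2,\dots$ are commuting indeterminates. It lies in the ring of symmetric functions over $\mathbb{Q}$, which equals the polynomial ring $\mathbb{Q}[p_1,p_2,\dots]$ in the algebraically independent power sums $p_r=\sum_{i\ge1}x_i^r$. Thus $\partial X_G/\partial p_1$ is defined by regarding $X_G$ as a polynomial in $p_1,p_2,\dots$, and $$\Phi_G=\left.\frac{\partial X_G}{\partial p_1}\right|_{p_1=0}.$$ A leaf of a tree is a vertex of degree $1$. A tree with at least three vertices is proper if every non-leaf vertex is adjacent to a leaf. Let $T$ be a proper tree with non-leaf vertices $c_1,\dots,c_k$. The weighted skeleton of $T$ is the pair $(S,\mathbf w)$, where $S$ is the tree with vertex set $[k]=\{1,\dots,k\}$ in which $ij$ is an edge exactly when $c_ic_j$ is an edge of $T$, and $\mathbf w(i)=w_i$ is $1$ plus the number of leaves of $T$ adjacent to $c_i$. The weighted skeleton is multiplicity-isolated if every weight that occurs at more than one vertex of $S$ occurs only at leaves of $S$. *)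

theory Defs
  imports
    "HOL-Library.Poly_Mapping"
    "HOL-Library.FuncSet"
    "Graph_Theory.Digraph_Component"
    "Graph_Theory.Digraph_Isomorphism"
begin

section \<open>Formal power series in countably many commuting indeterminates\<close>

text \<open>
  A monomial \<open>x_0^{m 0} x_1^{m 1} ...\<close> is represented by its finitely supported exponent
  function; a series is an arbitrary family of rational coefficients indexed by monomials.
\<close>

typedef xseries = "UNIV :: ((nat \<Rightarrow>\<^sub>0 nat) \<Rightarrow> rat) set"
  morphisms xcoeff XSeries ..

setup_lifting type_definition_xseries

lemma xseries_eqI: "(\<And>m. xcoeff f m = xcoeff g m) \<Longrightarrow> f = g"
  by (simp add: xcoeff_inject[symmetric] fun_eq_iff)

lemma finite_antidiagonal: "finite {(a, b). a + b = (m :: nat \<Rightarrow>\<^sub>0 nat)}"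
proof -
  have "finite (Poly_Mapping.keys m \<rightarrow>\<^sub>E {..Max (insert 0 (Poly_Mapping.lookup m ` Poly_Mapping.keys m))})"
    (is "finite ?F") by (intro finite_PiE) auto
  let ?r = "\<lambda>a. restrict (Poly_Mapping.lookup a) (Poly_Mapping.keys m)"
  have "inj_on ?r {a. \<exists>b. a + b = m}"
  proof (rule inj_onI, clarsimp)
    fix a a' b b' :: "nat \<Rightarrow>\<^sub>0 nat"
    assume r: "restrict (Poly_Mapping.lookup a) (Poly_Mapping.keys (a + b))
      = restrict (Poly_Mapping.lookup a') (Poly_Mapping.keys (a + b))"
      and e: "a' + b' = a + b"
    show "a = a'"
    proof (rule poly_mapping_eqI)
      fix k
      show "Poly_Mapping.lookup a k = Poly_Mapping.lookup a' k"
      proof (cases "k \<in> Poly_Mapping.keys (a + b)")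
        case True
        then show ?thesis using fun_cong[OF r, of k] by simp
      next
        case False
        then have "Poly_Mapping.lookup (a + b) k = 0"
          by (simp add: in_keys_iff)
        moreover from this have "Poly_Mapping.lookup (a' + b') k = 0"
          using e by simp
        ultimately show ?thesis by (simp add: lookup_add)
      qed
    qed
  qed
  moreover have "?r ` {a. \<exists>b. a + b = m} \<subseteq> ?F"
  proof clarsimp
    fix a b k :: "nat \<Rightarrow>\<^sub>0 nat" and i :: nat
    assume m: "m = a + b" and i: "i \<in> Poly_Mapping.keys (a + b)"
    have "Poly_Mapping.lookup a i \<le> Poly_Mapping.lookup (a + b) i"
      by (simp add: lookup_add)
    also have "\<dots> \<le> Max (insert 0 (Poly_Mapping.lookup (a + b) ` Poly_Mapping.keys (a + b)))"
      using i by (intro Max_ge) auto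
    finally show "Poly_Mapping.lookup a i
      \<le> Max (insert 0 (Poly_Mapping.lookup (a + b) ` Poly_Mapping.keys (a + b)))" .
  qed
  ultimately have fa: "finite {a. \<exists>b. a + b = m}"
    using \<open>finite ?F\<close> by (meson finite_imageD finite_subset)
  have "{(a, b). a + b = m} \<subseteq> (\<lambda>a. (a, m - a)) ` {a. \<exists>b. a + b = m}"
    by force
  then show ?thesis using fa by (meson finite_imageI finite_subset)
qed

instantiation xseries :: comm_ring_1
begin

lift_definition zero_xseries :: xseries is "\<lambda>_. 0" .
lift_definition one_xseries :: xseries is "\<lambda>m. if m = 0 then 1 else 0" .
lift_definition plus_xseries :: "xseries \<Rightarrow> xseries \<Rightarrow> xseries" is "\<lambda>f g m. f m + g m" .
lift_definition minus_xseries :: "xseries \<Rightarrow> xseries \<Rightarrow> xseries" is "\<lambda>f g m. f m - g m" .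
lift_definition uminus_xseries :: "xseries \<Rightarrow> xseries" is "\<lambda>f m. - f m" .
lift_definition times_xseries :: "xseries \<Rightarrow> xseries \<Rightarrow> xseries" is
  "\<lambda>f g m. \<Sum>(a, b) \<in> {(a, b). a + b = m}. f a * g b" .

instance
proof
  fix f g h :: xseries
  show "f * g * h = f * (g * h)"
  proof (rule xseries_eqI)
    fix m
    let ?f = "xcoeff f" and ?g = "xcoeff g" and ?h = "xcoeff h"
    let ?D = "\<lambda>m :: nat \<Rightarrow>\<^sub>0 nat. {(a, b). a + b = m}"
    have "xcoeff (f * g * h) m = (\<Sum>(s, c)\<in>?D m. \<Sum>(a, b)\<in>?D s. ?f a * ?g b * ?h c)"
      by (simp add: times_xseries.rep_eq sum_distrib_right case_prod_unfold)
    also have "\<dots> = (\<Sum>p\<in>Sigma (?D m) (\<lambda>p. ?D (fst p)).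
        ?f (fst (snd p)) * ?g (snd (snd p)) * ?h (snd (fst p)))"
      by (simp add: sum.Sigma finite_antidiagonal[unfolded case_prod_unfold] case_prod_unfold)
    also have "\<dots> = (\<Sum>p\<in>Sigma (?D m) (\<lambda>p. ?D (snd p)).
        ?f (fst (fst p)) * (?g (fst (snd p)) * ?h (snd (snd p))))"
      by (rule sum.reindex_bij_witness[where
            i = "\<lambda>p. ((fst (fst p) + fst (snd p), snd (snd p)), (fst (fst p), fst (snd p)))" and
            j = "\<lambda>p. ((fst (snd p), snd (snd p) + snd (fst p)), (snd (snd p), snd (fst p)))"])
        (auto simp: add.assoc mult.assoc)
    also have "\<dots> = (\<Sum>(a, s)\<in>?D m. \<Sum>(b, c)\<in>?D s. ?f a * (?g b * ?h c))"
      by (simp add: sum.Sigma finite_antidiagonal[unfolded case_prod_unfold] case_prod_unfold)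
    also have "\<dots> = xcoeff (f * (g * h)) m"
      by (simp add: times_xseries.rep_eq sum_distrib_left case_prod_unfold)
    finally show "xcoeff (f * g * h) m = xcoeff (f * (g * h)) m" .
  qed
  show "f * g = g * f"
    by (rule xseries_eqI, simp add: times_xseries.rep_eq,
        rule sum.reindex_bij_witness[where i = prod.swap and j = prod.swap])
      (auto simp: add.commute mult.commute)
  show "1 * f = f"
  proof (rule xseries_eqI)
    fix m
    have "xcoeff (1 * f) m
      = (\<Sum>p\<in>{(a, b). a + b = m}. if p = (0, m) then xcoeff f m else 0)"
      unfolding times_xseries.rep_eq by (rule sum.cong) (auto simp: one_xseries.rep_eq split: if_splits)
    also have "\<dots> = xcoeff f m"
      by (subst sum.delta) (auto simp: finite_antidiagonal)
    finally show "xcoeff (1 * f) m = xcoeff f m" .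
  qed
  show "(f + g) * h = f * h + g * h"
    by (rule xseries_eqI)
      (simp add: times_xseries.rep_eq plus_xseries.rep_eq distrib_right sum.distrib case_prod_unfold)
  show "f + g + h = f + (g + h)" by transfer (simp add: add.assoc)
  show "f + g = g + f" by transfer (simp add: add.commute)
  show "0 + f = f" by transfer simp
  show "- f + f = 0" by transfer simp
  show "f - g = f + - g" by transfer simp
  show "(0 :: xseries) \<noteq> 1" by transfer (auto simp: fun_eq_iff)
qed

end

lift_definition xconst :: "rat \<Rightarrow> xseries" is "\<lambda>c m. if m = 0 then c else 0" .

text \<open>The indeterminates of interest are \<open>x_1, x_2, ...\<close>; the variable \<open>x_0\<close> is never used.\<close>

lift_definition power_sum :: "nat \<Rightarrow> xseries" is
  "\<lambda>r m. if \<exists>i\<ge>1. m = Poly_Mapping.single i r then 1 else 0" .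

section \<open>Polynomials in the power sums\<close>

text \<open>
  An element of \<open>ppoly\<close> is a polynomial over the rationals in formal variables indexed by
  \<open>nat\<close>, the variable with index \<open>r\<close> standing for \<open>p_r\<close>. Since there is no power sum
  \<open>p_0\<close>, the ring of polynomials in \<open>p_1, p_2, ...\<close> is the subset \<open>power_sum_ring\<close>.
\<close>

type_synonym ppoly = "(nat \<Rightarrow>\<^sub>0 nat) \<Rightarrow>\<^sub>0 rat"

definition power_sum_ring :: "ppoly set" where
  "power_sum_ring = {P. \<forall>\<mu> \<in> Poly_Mapping.keys P. 0 \<notin> Poly_Mapping.keys \<mu>}"

text \<open>Substitution of \<open>f r\<close> for the variable \<open>r\<close>, where \<open>c\<close> embeds the scalars.\<close>

definition ppoly_subst :: "(rat \<Rightarrow> 'a) \<Rightarrow> (nat \<Rightarrow> 'a) \<Rightarrow> ppoly \<Rightarrow> 'a :: comm_ring_1" where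
  "ppoly_subst c f P =
    (\<Sum>\<mu> \<in> Poly_Mapping.keys P.
      c (Poly_Mapping.lookup P \<mu>) * (\<Prod>r \<in> Poly_Mapping.keys \<mu>. f r ^ Poly_Mapping.lookup \<mu> r))"

definition ppoly_var :: "nat \<Rightarrow> ppoly" where
  "ppoly_var r = Poly_Mapping.single (Poly_Mapping.single r 1) 1"

definition ppoly_pderiv :: "nat \<Rightarrow> ppoly \<Rightarrow> ppoly" where
  "ppoly_pderiv r P =
    (\<Sum>\<mu> \<in> Poly_Mapping.keys P.
      Poly_Mapping.single (\<mu> - Poly_Mapping.single r 1)
        (of_nat (Poly_Mapping.lookup \<mu> r) * Poly_Mapping.lookup P \<mu>))"

definition ppoly_set_zero :: "nat \<Rightarrow> ppoly \<Rightarrow> ppoly" where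
  "ppoly_set_zero r P =
    ppoly_subst (Poly_Mapping.single 0) (\<lambda>s. if s = r then 0 else ppoly_var s) P"

section \<open>The chromatic symmetric function\<close>

text \<open>
  Finite simple undirected graphs are the finite, loop-free, symmetric relations described by the
  locale \<open>pair_graph\<close>; an edge \<open>uv\<close> is present as both arcs \<open>(u, v)\<close> and \<open>(v, u)\<close>.
  Colorings are extensional functions, so that each coloring of the vertex set is counted once.
\<close>

definition proper_colorings :: "'a pair_pre_digraph \<Rightarrow> ('a \<Rightarrow> nat) set" where
  "proper_colorings G =
    {\<kappa> \<in> pverts G \<rightarrow>\<^sub>E {1..}. \<forall>(u, v) \<in> parcs G. \<kappa> u \<noteq> \<kappa> v}"

text \<open>
  The coefficient of a monomial in the sum of \<open>\<Prod>v. x_{\<kappa> v}\<close> over all proper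
  colorings \<open>\<kappa>\<close> is the (finite) number of proper colorings with that monomial.
\<close>

lift_definition chromatic_sym :: "'a pair_pre_digraph \<Rightarrow> xseries" is
  "\<lambda>G m. of_nat (card {\<kappa> \<in> proper_colorings G.
    (\<Sum>v \<in> pverts G. Poly_Mapping.single (\<kappa> v) 1) = m})" .

text \<open>
  Existence of this expansion is the fact that chromatic symmetric functions are symmetric, and
  uniqueness is the algebraic independence of the power sums.
\<close>

definition chromatic_ppoly :: "'a pair_pre_digraph \<Rightarrow> ppoly" where
  "chromatic_ppoly G =
    (THE P. P \<in> power_sum_ring \<and> ppoly_subst xconst power_sum P = chromatic_sym G)"

definition Phi :: "'a pair_pre_digraph \<Rightarrow> ppoly" where
  "Phi G = ppoly_set_zero 1 (ppoly_pderiv 1 (chromatic_ppoly G))"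

section \<open>Proper trees and their weighted skeletons\<close>

text \<open>
  In a symmetric digraph every edge yields a directed cycle of length two, so the predicate
  \<open>tree\<close> of the digraph library does not describe undirected trees: a cycle of a simple
  undirected graph is a directed cycle of length at least three.
\<close>

definition undirected_tree :: "'a pair_pre_digraph \<Rightarrow> bool" where
  "undirected_tree G \<longleftrightarrow>
    pair_graph G \<and> Digraph_Component.connected (with_proj G) \<and>
    \<not> (\<exists>p. pre_digraph.cycle (with_proj G) p \<and> length p \<ge> 3)"

text \<open>For symmetric digraphs the out-degree is the undirected degree.\<close>

definition leaves :: "'a pair_pre_digraph \<Rightarrow> 'a set" where
  "leaves G = {v \<in> pverts G. out_degree (with_proj G) v = 1}"

definition proper_tree :: "'a pair_pre_digraph \<Rightarrow> bool" where
  "proper_tree T \<longleftrightarrow>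
    undirected_tree T \<and> card (pverts T) \<ge> 3 \<and>
    (\<forall>c \<in> pverts T - leaves T. \<exists>l \<in> leaves T. (c, l) \<in> parcs T)"

text \<open>
  The skeleton is kept on the non-leaf vertices \<open>c_1, ..., c_k\<close> themselves instead of
  renaming them to \<open>1, ..., k\<close>.
\<close>

definition skeleton :: "'a pair_pre_digraph \<Rightarrow> 'a pair_pre_digraph" where
  "skeleton T =
    \<lparr>pverts = pverts T - leaves T,
     parcs = {(u, v) \<in> parcs T. u \<notin> leaves T \<and> v \<notin> leaves T}\<rparr>"

definition skeleton_weight :: "'a pair_pre_digraph \<Rightarrow> 'a \<Rightarrow> nat" where
  "skeleton_weight T c = 1 + card {l \<in> leaves T. (c, l) \<in> parcs T}"

definition weighted_skeleton :: "'a pair_pre_digraph \<Rightarrow> 'a pair_pre_digraph \<times> ('a \<Rightarrow> nat)" where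
  "weighted_skeleton T = (skeleton T, skeleton_weight T)"

fun multiplicity_isolated :: "'a pair_pre_digraph \<times> ('a \<Rightarrow> nat) \<Rightarrow> bool" where
  "multiplicity_isolated (S, w) \<longleftrightarrow>
    (\<forall>a. card {i \<in> pverts S. w i = a} > 1 \<longrightarrow> (\<forall>i \<in> pverts S. w i = a \<longrightarrow> i \<in> leaves S))"

end

theory Submission
  imports Defs
begin

text \<open>
  By Stanley's expansion, the chromatic symmetric function of a graph is the sum of
  \<open>(-1)^|S| p_\<lambda>(S)\<close> over all edge sets \<open>S\<close>, where \<open>\<lambda>(S)\<close> is the multiset of the sizes of
  the components of \<open>(V, S)\<close>. Differentiating by \<open>p_1\<close> and then setting \<open>p_1 = 0\<close> keeps
  those \<open>S\<close> that leave exactly one vertex isolated, and forgets that vertex. In a forest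
  \<open>S\<close> has \<open>|V| - |S|\<close> components, so the sign depends only on the number of parts of
  \<open>\<lambda>(S)\<close>: nothing cancels, and the coefficients of \<open>\<Phi>\<close> count edge sets.

  In a proper tree every non-leaf carries a leaf, so the isolated vertex must be a leaf \<open>l\<close>,
  and \<open>S\<close> consists of all leaf edges except that of \<open>l\<close> together with a set
  \<open>A\<close> of skeleton edges. The component sizes are then the weight sums of the components of
  \<open>A\<close> in the skeleton, after the weight of the neighbour of \<open>l\<close> has been lowered by one.
  The number of parts is \<open>k - |A|\<close>, where \<open>k\<close> is the order of the skeleton, and only three
  values of \<open>|A|\<close> are needed.

  \<^item> \<open>|A| = k - 1\<close>. The coefficient of \<open>p_(n-1)\<close> counts the leaves, which gives \<open>n\<close> and \<open>k\<close>.

  \<^item> \<open>|A| = 0\<close>. These terms come from the multiset \<open>M\<close> of all weights by lowering one weight,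
  and \<open>M\<close> can be read off from them (\<open>weights_from_leaf_removals\<close>).

  \<^item> \<open>|A| = 1\<close>. An edge joining weights \<open>a\<close> and \<open>b\<close> contributes the type
  \<open>M - {a, b} + {a + b - 1}\<close>. The only other pairs that contribute to this type have sum
  \<open>a + b - 1\<close>, so the number of edges with each pair of end weights is found by induction on
  the sum (\<open>pairs_from_contraction_removals\<close>).

  Multiplicity isolation enters when the tree is rebuilt from its weights and its pairs of
  adjacent weights. If repeated weights occur only at leaves of one skeleton, counting
  incidences shows the same for the other skeleton. Vertices of unique weight are then recognised
  by their weight, and a skeleton leaf of repeated weight is attached to a vertex of known
  weight (\<open>inner_edge_transfer\<close>).
\<close>

section \<open>Coefficients of products of power sums\<close>

text \<open>
  A partition is handled as the multiset of its parts; this is the exponent of the monomial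
  \<open>p_\<lambda>\<close> for the partition \<open>\<lambda>\<close>.
\<close>

definition mono_of_mset :: "nat multiset \<Rightarrow> (nat \<Rightarrow>\<^sub>0 nat)" where
  "mono_of_mset M = (\<Sum>x\<in>#M. Poly_Mapping.single x 1)"

lemma mono_of_mset_add [simp]:
  "mono_of_mset (M + N) = mono_of_mset M + mono_of_mset N"
  "mono_of_mset (add_mset x M) = Poly_Mapping.single x 1 + mono_of_mset M"
  "mono_of_mset {#} = 0"
  by (simp_all add: mono_of_mset_def)

lemma lookup_mono_of_mset [simp]: "Poly_Mapping.lookup (mono_of_mset M) = count M"
  by (induction M) (auto simp: lookup_add lookup_single when_def fun_eq_iff)

lemma keys_mono_of_mset [simp]: "Poly_Mapping.keys (mono_of_mset M) = set_mset M"
  by (auto simp: in_keys_iff not_in_iff)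

lemma inj_mono_of_mset: "inj mono_of_mset"
  by (rule injI) (metis lookup_mono_of_mset multiset_eqI)

lemma mono_of_mset_eq_iff [simp]: "mono_of_mset M = mono_of_mset N \<longleftrightarrow> M = N"
  using inj_mono_of_mset by (auto dest: injD)

lemma mono_of_mset_cases: obtains M where "\<mu> = mono_of_mset M"
proof -
  have "finite {x. 0 < Poly_Mapping.lookup \<mu> x}"
    using finite_keys[of \<mu>] by (simp add: Poly_Mapping.keys.rep_eq)
  then have "Poly_Mapping.lookup (mono_of_mset (Abs_multiset (Poly_Mapping.lookup \<mu>))) = Poly_Mapping.lookup \<mu>"
    by (simp add: Abs_multiset_inverse)
  then have "\<mu> = mono_of_mset (Abs_multiset (Poly_Mapping.lookup \<mu>))"
    by (metis poly_mapping_eqI)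
  then show ?thesis by (rule that)
qed

lemma ppoly_subst_superset:
  assumes "c 0 = 0" "finite K" "Poly_Mapping.keys P \<subseteq> K"
  shows "ppoly_subst c f P =
    (\<Sum>\<mu>\<in>K. c (Poly_Mapping.lookup P \<mu>) * (\<Prod>r\<in>Poly_Mapping.keys \<mu>. f r ^ Poly_Mapping.lookup \<mu> r))"
  unfolding ppoly_subst_def using assms
  by (intro sum.mono_neutral_left) (auto simp: in_keys_iff)

lemma ppoly_subst_add:
  assumes "c 0 = 0" "\<And>a b. c (a + b) = c a + c b"
  shows "ppoly_subst c f (P + Q) = ppoly_subst c f P + ppoly_subst c f Q"
proof -
  let ?K = "Poly_Mapping.keys P \<union> Poly_Mapping.keys Q"
  have "Poly_Mapping.keys (P + Q) \<subseteq> ?K" by (rule keys_add)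
  then show ?thesis using assms
    by (subst (1 2 3) ppoly_subst_superset[where K = ?K])
      (auto simp: lookup_add sum.distrib distrib_right)
qed

lemma ppoly_subst_sum:
  assumes "c 0 = 0" "\<And>a b. c (a + b) = c a + c b"
  shows "ppoly_subst c f (\<Sum>i\<in>I. P i) = (\<Sum>i\<in>I. ppoly_subst c f (P i))"
proof (induction I rule: infinite_finite_induct)
  case (insert i I)
  then show ?case using ppoly_subst_add[OF assms] by simp
qed (simp_all add: ppoly_subst_def)

lemma ppoly_subst_single:
  assumes "c 0 = 0"
  shows "ppoly_subst c f (Poly_Mapping.single (mono_of_mset M) a) = c a * (\<Prod>r\<in>#M. f r)"
  using assms
  by (subst ppoly_subst_superset[where K = "{mono_of_mset M}"])
    (auto simp: image_prod_mset_multiplicity)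

lemma xcoeff_simps [simp]:
  "xcoeff 0 m = 0"
  "xcoeff (f + g) m = xcoeff f m + xcoeff g m"
  by (simp_all add: zero_xseries.rep_eq plus_xseries.rep_eq)

lemma xcoeff_sum: "xcoeff (\<Sum>i\<in>I. f i) m = (\<Sum>i\<in>I. xcoeff (f i) m)"
  by (induction I rule: infinite_finite_induct) auto

lemma xconst_0: "xconst 0 = 0" and xconst_add: "xconst (a + b) = xconst a + xconst b"
  by (transfer; auto)+

lemma xcoeff_xconst_mult: "xcoeff (xconst c * f) m = c * xcoeff f m"
proof -
  have "xcoeff (xconst c * f) m
      = (\<Sum>p\<in>{(a, b). a + b = m}. if p = (0, m) then c * xcoeff f m else 0)"
    unfolding times_xseries.rep_eq by (rule sum.cong) (auto simp: xconst.rep_eq split: if_splits)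
  also have "\<dots> = c * xcoeff f m"
    by (subst sum.delta) (auto simp: finite_antidiagonal)
  finally show ?thesis .
qed

text \<open>
  A choice of one variable for every factor of \<open>\<Prod>j. p_(r j)\<close> such that the product of the chosen
  powers is the monomial \<open>m\<close>. The same set describes the colorings with monomial \<open>m\<close> that
  are constant on the blocks \<open>j\<close> of sizes \<open>r j\<close>.
\<close>

definition placements :: "'j set \<Rightarrow> ('j \<Rightarrow> nat) \<Rightarrow> (nat \<Rightarrow>\<^sub>0 nat) \<Rightarrow> ('j \<Rightarrow> nat) set" where
  "placements J r m = {f \<in> J \<rightarrow>\<^sub>E {1..}. (\<Sum>j\<in>J. Poly_Mapping.single (f j) (r j)) = m}"

lemma lookup_sum_single:
  "Poly_Mapping.lookup (\<Sum>j\<in>J. Poly_Mapping.single (f j) (r j)) i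
    = (\<Sum>j\<in>J. if f j = i then r j else (0::nat))"
  by (auto simp: lookup_sum lookup_single when_def intro: sum.cong)

lemma finite_placements:
  assumes "finite J" "\<And>j. j \<in> J \<Longrightarrow> r j > 0"
  shows "finite (placements J r m)"
proof (rule finite_subset)
  show "placements J r m \<subseteq> J \<rightarrow>\<^sub>E Poly_Mapping.keys m"
  proof
    fix f assume f: "f \<in> placements J r m"
    have "f j \<in> Poly_Mapping.keys m" if "j \<in> J" for j
    proof -
      have "r j \<le> (\<Sum>i\<in>J. if f i = f j then r i else 0)"
        using member_le_sum[of j J "\<lambda>i. if f i = f j then r i else 0"] that assms(1) by auto
      also have "\<dots> = Poly_Mapping.lookup m (f j)"
        using f lookup_sum_single[of f r J "f j"] by (auto simp: placements_def)
      finally show ?thesis using assms(2)[OF that] by (simp add: in_keys_iff)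
    qed
    then show "f \<in> J \<rightarrow>\<^sub>E Poly_Mapping.keys m" using f by (auto simp: placements_def PiE_iff)
  qed
  show "finite (J \<rightarrow>\<^sub>E Poly_Mapping.keys m)" using assms by (intro finite_PiE) auto
qed

lemma single_eq_single_iff: "r > 0 \<Longrightarrow> Poly_Mapping.single i r = Poly_Mapping.single j (r::nat) \<longleftrightarrow> i = j"
  by (metis lookup_single_eq lookup_single_not_eq less_irrefl)

text \<open>
  Expanding the product picks one term \<open>x_i^(r j)\<close> from every factor. The exponents must be
  positive: \<open>power_sum 0\<close> is the constant \<open>1\<close>, whereas every variable would be a valid
  choice for it.
\<close>

lemma xcoeff_prod_power_sum:
  assumes "finite J" "\<And>j. j \<in> J \<Longrightarrow> r j > 0"
  shows "xcoeff (\<Prod>j\<in>J. power_sum (r j)) m = of_nat (card (placements J r m))"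
  using assms
proof (induction J arbitrary: m rule: finite_induct)
  case empty
  have "placements {} r m = (if m = 0 then {\<lambda>_. undefined} else {})"
    by (auto simp: placements_def)
  then show ?case by (simp add: one_xseries.rep_eq)
next
  case (insert j J)
  define A where "A = {(a, b). a + b = m \<and> (\<exists>i\<ge>1. a = Poly_Mapping.single i (r j))}"
  have A: "A \<subseteq> {(a, b). a + b = m}" by (auto simp: A_def)
  have finA: "finite A" using A finite_antidiagonal by (rule finite_subset)
  have rj: "r j > 0" using insert.prems by auto
  have "xcoeff (\<Prod>j\<in>insert j J. power_sum (r j)) m
    = (\<Sum>(a, b)\<in>{(a, b). a + b = m}. xcoeff (power_sum (r j)) a * of_nat (card (placements J r b)))"
    using insert by (simp add: times_xseries.rep_eq)
  also have "\<dots> = (\<Sum>(a, b)\<in>A. of_nat (card (placements J r b)))"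
    using A by (intro sum.mono_neutral_cong_right finite_antidiagonal)
      (auto simp: A_def power_sum.rep_eq split: if_splits)
  also have "\<dots> = of_nat (card (SIGMA p:A. placements J r (snd p)))"
    using finA insert by (subst card_SigmaI) (auto simp: finite_placements case_prod_unfold)
  also have "card (SIGMA p:A. placements J r (snd p)) = card (placements (insert j J) r m)"
  proof (rule bij_betw_same_card[symmetric], rule bij_betw_imageI)
    let ?h = "\<lambda>f. ((Poly_Mapping.single (f j) (r j), \<Sum>i\<in>J. Poly_Mapping.single (f i) (r i)), restrict f J)"
    have ext: "f \<in> insert j J \<rightarrow>\<^sub>E {1..}" if "f \<in> placements (insert j J) r m" for f
      using that by (auto simp: placements_def)
    show "inj_on ?h (placements (insert j J) r m)"
    proof (rule inj_onI)
      fix f g assume f: "f \<in> placements (insert j J) r m" and g: "g \<in> placements (insert j J) r m"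
        and e: "?h f = ?h g"
      show "f = g"
      proof (rule PiE_ext[OF ext[OF f] ext[OF g]])
        fix x assume "x \<in> insert j J"
        then show "f x = g x"
          using e rj by (auto simp: single_eq_single_iff restrict_def dest: fun_cong[of _ _ x])
      qed
    qed
    show "?h ` placements (insert j J) r m = (SIGMA p:A. placements J r (snd p))"
    proof (intro equalityI subsetI)
      fix q assume "q \<in> ?h ` placements (insert j J) r m"
      then show "q \<in> (SIGMA p:A. placements J r (snd p))"
        using insert.hyps by (force simp: A_def placements_def)
    next
      fix q assume "q \<in> (SIGMA p:A. placements J r (snd p))"
      then obtain i b g where q: "q = ((Poly_Mapping.single i (r j), b), g)" and i: "i \<ge> 1"
        and m: "Poly_Mapping.single i (r j) + b = m" and g: "g \<in> placements J r b"
        by (auto simp: A_def)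
      have gs: "(\<Sum>x\<in>J. Poly_Mapping.single ((g(j := i)) x) (r x)) = b"
        using g insert.hyps by (auto simp: placements_def intro!: sum.cong)
      have "g(j := i) \<in> placements (insert j J) r m"
        using g i m gs insert.hyps by (auto simp: placements_def PiE_iff extensional_def)
      moreover have "restrict (g(j := i)) J = g"
        using g insert.hyps by (auto simp: placements_def PiE_iff extensional_def restrict_def fun_eq_iff)
      ultimately show "q \<in> ?h ` placements (insert j J) r m"
        unfolding q using gs by (intro image_eqI[of _ _ "g(j := i)"]) auto
    qed
  qed
  finally show ?case .
qed

text \<open>
  For a partition with parts \<open>ys\<close> this is the monomial \<open>x_1^(ys_1) x_2^(ys_2) ...\<close>. A product
  of power sums contains it only if the parts of the product can be merged into \<open>ys\<close>.
\<close>

definition staircase :: "nat list \<Rightarrow> (nat \<Rightarrow>\<^sub>0 nat)" where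
  "staircase ys = (\<Sum>j<length ys. Poly_Mapping.single (Suc j) (ys ! j))"

lemma lookup_staircase:
  "Poly_Mapping.lookup (staircase ys) i = (if i \<in> Suc ` {..<length ys} then ys ! (i - 1) else 0)"
  unfolding staircase_def lookup_sum_single
  by (cases i) (auto simp: sum.delta image_iff)

lemma image_mset_nth: "image_mset (nth xs) (mset_set {..<length xs}) = mset xs"
proof -
  have "image_mset (nth xs) (mset_set {..<length xs}) = mset (map (nth xs) [0..<length xs])"
    by (simp add: lessThan_atLeast0)
  then show ?thesis by (simp add: map_nth)
qed

text \<open>
  Every variable of the staircase monomial must be chosen by some factor, so the product has at
  least as many factors. With equally many, each variable is chosen once, and its exponent is a
  single part.
\<close>

lemma placements_staircase:
  assumes f: "f \<in> placements {..<length xs} (nth xs) (staircase ys)"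
    and pos: "0 \<notin> set xs" "0 \<notin> set ys"
  shows "length ys \<le> length xs"
    and "length ys = length xs \<Longrightarrow> mset xs = mset ys"
proof -
  let ?I = "{..<length xs}" and ?J = "Suc ` {..<length ys}" and ?l = "Poly_Mapping.lookup (staircase ys)"
  have lk: "?l i = (\<Sum>j\<in>?I. if f j = i then xs ! j else 0)" for i
    using f lookup_sum_single[of f "nth xs" ?I i] by (simp add: placements_def)
  have xpos: "xs ! j > 0" if "j < length xs" for j using that pos(1) by (metis nth_mem gr0I)
  have sup: "?J \<subseteq> f ` ?I"
  proof
    fix i assume i: "i \<in> ?J"
    then have "?l i = ys ! (i - 1)" "i - 1 < length ys" by (auto simp: lookup_staircase)
    then have "?l i \<noteq> 0" using pos(2) by (metis nth_mem)
    moreover have "?l i = 0" if "i \<notin> f ` ?I"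
      unfolding lk using that by (intro sum.neutral) auto
    ultimately show "i \<in> f ` ?I" by metis
  qed
  have cJ: "card ?J = length ys" by (simp add: card_image)
  have cI: "card (f ` ?I) \<le> length xs" using card_image_le[of ?I f] by simp
  show "length ys \<le> length xs" using card_mono[OF _ sup] cJ cI by simp
  assume l: "length ys = length xs"
  have img: "f ` ?I = ?J" using card_seteq[OF _ sup] cI cJ l by simp
  then have inj: "inj_on f ?I" using cJ l by (intro eq_card_imp_inj_on) auto
  have xl: "xs ! j = ?l (f j)" if "j \<in> ?I" for j
  proof -
    have "?l (f j) = (\<Sum>i\<in>?I. if i = j then xs ! i else 0)"
      unfolding lk using inj that by (intro sum.cong) (auto dest: inj_onD)
    then show ?thesis using that by simp
  qed
  have "mset xs = image_mset (\<lambda>j. ?l (f j)) (mset_set ?I)"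
    unfolding image_mset_nth[of xs, symmetric] by (intro image_mset_cong) (simp add: xl)
  also have "\<dots> = image_mset ?l (mset_set (f ` ?I))"
    using inj by (simp add: image_mset_mset_set[symmetric] image_mset.compositionality comp_def)
  also have "\<dots> = image_mset (\<lambda>j. ?l (Suc j)) (mset_set {..<length ys})"
    unfolding img by (simp add: image_mset_mset_set[symmetric] image_mset.compositionality comp_def)
  also have "\<dots> = mset ys"
    unfolding image_mset_nth[of ys, symmetric] by (intro image_mset_cong) (simp add: lookup_staircase)
  finally show "mset xs = mset ys" .
qed

lemma xcoeff_prod_mset_power_sum:
  assumes "0 \<notin> set xs"
  shows "xcoeff (\<Prod>r\<in>#mset xs. power_sum r) m = of_nat (card (placements {..<length xs} (nth xs) m))"
proof -
  have "(\<Prod>r\<in>#mset xs. power_sum r) = (\<Prod>i<length xs. power_sum (xs ! i))"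
    unfolding image_mset_nth[of xs, symmetric]
    by (simp add: prod_unfold_prod_mset image_mset.compositionality comp_def)
  also have "xcoeff \<dots> m = of_nat (card (placements {..<length xs} (nth xs) m))"
    using assms by (intro xcoeff_prod_power_sum) (auto intro!: Nat.gr0I dest: nth_mem)
  finally show ?thesis .
qed

text \<open>
  Among the partitions \<open>\<lambda>\<close> occurring in \<open>P\<close> take one with the most parts. Its
  staircase monomial can arise only from partitions with at least as many parts, hence from
  \<open>p_\<lambda>\<close> alone, where its coefficient is positive.
\<close>

lemma power_sums_algebraically_independent:
  assumes P: "P \<in> power_sum_ring" and zero: "ppoly_subst xconst power_sum P = 0"
  shows "P = 0"
proof (rule ccontr)
  assume "P \<noteq> 0"
  define K where "K = {M. mono_of_mset M \<in> Poly_Mapping.keys P}"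
  have keys: "Poly_Mapping.keys P = mono_of_mset ` K"
    by (auto simp: K_def) (metis imageI mem_Collect_eq mono_of_mset_cases)
  have finK: "finite K"
    using finite_imageD[of mono_of_mset K] inj_on_subset[OF inj_mono_of_mset] keys finite_keys
    by (metis subset_UNIV)
  have "K \<noteq> {}" using \<open>P \<noteq> 0\<close> keys by auto
  then have "Max (size ` K) \<in> size ` K" using finK by (intro Max_in) auto
  then obtain M where M: "M \<in> K" and "size M = Max (size ` K)" by force
  then have max: "size N \<le> size M" if "N \<in> K" for N using finK that by simp
  have pos: "0 \<notin># N" if "N \<in> K" for N
    using P that by (force simp: power_sum_ring_def K_def)
  obtain ys where ys: "mset ys = M" using ex_mset by blast
  let ?c = "\<lambda>N. Poly_Mapping.lookup P (mono_of_mset N) * xcoeff (\<Prod>r\<in>#N. power_sum r) (staircase ys)"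
  have inj: "inj_on mono_of_mset K" using inj_mono_of_mset by (rule inj_on_subset) simp
  have "xcoeff (ppoly_subst xconst power_sum P) (staircase ys) = (\<Sum>N\<in>K. ?c N)"
    unfolding ppoly_subst_def keys xcoeff_sum sum.reindex[OF inj]
    by (simp add: xcoeff_xconst_mult image_prod_mset_multiplicity)
  also have "\<dots> = (\<Sum>N\<in>K. if N = M then ?c M else 0)"
  proof (rule sum.cong[OF refl])
    fix N assume N: "N \<in> K"
    obtain xs where xs: "mset xs = N" using ex_mset by blast
    have "placements {..<length xs} (nth xs) (staircase ys) = {}" if "N \<noteq> M"
    proof (rule ccontr)
      assume "placements {..<length xs} (nth xs) (staircase ys) \<noteq> {}"
      then obtain f where f: "f \<in> placements {..<length xs} (nth xs) (staircase ys)" by blast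
      have "0 \<notin> set xs" "0 \<notin> set ys" using pos[OF N] pos[OF M] xs ys by auto
      note * = placements_staircase[OF f this]
      have "length xs \<le> length ys" using max[OF N] xs ys by auto
      then show False using * that xs ys by auto
    qed
    then show "?c N = (if N = M then ?c M else 0)"
      using xcoeff_prod_mset_power_sum[of xs] pos[OF N] xs by auto
  qed
  also have "\<dots> = ?c M" using finK M by simp
  finally have "?c M = 0" using zero by simp
  moreover have "Poly_Mapping.lookup P (mono_of_mset M) \<noteq> 0"
    using M by (simp add: K_def in_keys_iff)
  moreover have "restrict Suc {..<length ys} \<in> placements {..<length ys} (nth ys) (staircase ys)"
    by (auto simp: placements_def staircase_def)
  moreover have "finite (placements {..<length ys} (nth ys) (staircase ys))"
    using pos[OF M] ys by (intro finite_placements) (auto intro!: Nat.gr0I dest: nth_mem)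
  ultimately show False
    using xcoeff_prod_mset_power_sum[of ys "staircase ys"] pos[OF M] ys by auto
qed

section \<open>Components of edge sets\<close>

text \<open>
  Edge sets are sets of two-element vertex sets. An edge set is turned into a symmetric
  relation whose reflexive transitive closure describes its components.
\<close>

definition arcs_of :: "'a set set \<Rightarrow> 'a rel" where
  "arcs_of S = {(u, v). {u, v} \<in> S}"

definition linked :: "'a set set \<Rightarrow> 'a rel" where
  "linked S = (arcs_of S)\<^sup>*"

definition component :: "'a set set \<Rightarrow> 'a \<Rightarrow> 'a set" where
  "component S x = linked S `` {x}"

definition components :: "'a set \<Rightarrow> 'a set set \<Rightarrow> 'a set set" where
  "components V S = component S ` V"

definition comp_sizes :: "'a set \<Rightarrow> 'a set set \<Rightarrow> nat multiset" where
  "comp_sizes V S = image_mset card (mset_set (components V S))"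

lemma count_image_mset_set:
  "finite A \<Longrightarrow> count (image_mset f (mset_set A)) y = card {x \<in> A. f x = y}"
  by (auto simp: count_image_mset' intro!: arg_cong[of _ _ card])

lemma sym_arcs_of: "sym (arcs_of S)"
  by (auto simp: arcs_of_def sym_def insert_commute)

lemma linked_refl [simp]: "(x, x) \<in> linked S"
  by (simp add: linked_def)

lemma linked_sym: "(x, y) \<in> linked S \<Longrightarrow> (y, x) \<in> linked S"
  unfolding linked_def by (metis symD sym_rtrancl sym_arcs_of)

lemma linked_trans: "(x, y) \<in> linked S \<Longrightarrow> (y, z) \<in> linked S \<Longrightarrow> (x, z) \<in> linked S"
  unfolding linked_def by (rule rtrancl_trans)

lemma linked_edge: "{x, y} \<in> S \<Longrightarrow> (x, y) \<in> linked S"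
  unfolding linked_def by (auto simp: arcs_of_def)

lemma linked_mono: "S \<subseteq> S' \<Longrightarrow> linked S \<subseteq> linked S'"
  unfolding linked_def by (intro rtrancl_mono) (auto simp: arcs_of_def)

text \<open>
  Constancy along edges is the tool for showing that vertices are not linked.
\<close>

lemma linked_invariant:
  assumes "(x, y) \<in> linked S" "\<And>u v. {u, v} \<in> S \<Longrightarrow> h u = h v"
  shows "h x = h y"
  using assms(1) unfolding linked_def by induction (auto simp: arcs_of_def dest: assms(2))

lemma mem_component [simp]: "y \<in> component S x \<longleftrightarrow> (x, y) \<in> linked S"
  by (simp add: component_def)

lemma component_nonempty [simp]: "component S x \<noteq> {}"
  by (metis empty_iff linked_refl mem_component)

lemma component_eq_iff: "component S x = component S y \<longleftrightarrow> (x, y) \<in> linked S"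
proof
  show "component S x = component S y \<Longrightarrow> (x, y) \<in> linked S"
    by (metis linked_refl mem_component)
  show "(x, y) \<in> linked S \<Longrightarrow> component S x = component S y"
    unfolding set_eq_iff mem_component by (metis linked_trans linked_sym)
qed

text \<open>
  A walk that uses a new edge can be cut down to use it only once.
\<close>

lemma linked_insert:
  "(x, y) \<in> linked (insert {u, v} S) \<longleftrightarrow>
    (x, y) \<in> linked S \<or> (x, u) \<in> linked S \<and> (v, y) \<in> linked S \<or>
    (x, v) \<in> linked S \<and> (u, y) \<in> linked S" (is "_ \<longleftrightarrow> ?R x y")
proof
  assume "(x, y) \<in> linked (insert {u, v} S)"
  then show "?R x y"
    unfolding linked_def[of "insert _ _"]
  proof (induction rule: rtrancl_induct)
    case (step y z)
    from step.hyps(2) consider "y = u" "z = v" | "y = v" "z = u" | "(y, z) \<in> linked S"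
      by (auto simp: arcs_of_def doubleton_eq_iff intro: linked_edge)
    then show ?case using step.IH by cases (auto intro: linked_trans linked_sym)
  qed auto
next
  have m: "p \<in> linked S \<Longrightarrow> p \<in> linked (insert {u, v} S)" for p
    using linked_mono[of S "insert {u, v} S"] by blast
  have "(u, v) \<in> linked (insert {u, v} S)" by (simp add: linked_edge)
  then show "?R x y \<Longrightarrow> (x, y) \<in> linked (insert {u, v} S)"
    by (meson m linked_trans linked_sym)
qed

lemma component_insert:
  "component (insert {u, v} S) x =
    (if (x, u) \<in> linked S \<or> (x, v) \<in> linked S then component S u \<union> component S v
     else component S x)"
  unfolding set_eq_iff by (auto simp: linked_insert) (metis linked_trans linked_sym)+

lemma components_insert:
  assumes "u \<in> V" "v \<in> V"
  shows "components V (insert {u, v} S) = insert (component S u \<union> component S v)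
    (components V S - {component S u, component S v})"
proof -
  let ?P = "\<lambda>x. (x, u) \<in> linked S \<or> (x, v) \<in> linked S" and ?UW = "component S u \<union> component S v"
  have "(\<lambda>x. if ?P x then ?UW else component S x) ` V
    = (\<lambda>x. ?UW) ` {x \<in> V. ?P x} \<union> component S ` {x \<in> V. \<not> ?P x}"
    unfolding if_image_distrib by (simp only: Int_def mem_Collect_eq)
  also have "(\<lambda>x. ?UW) ` {x \<in> V. ?P x} = {?UW}" using assms by auto
  finally have "components V (insert {u, v} S) = insert ?UW
    (component S ` {x \<in> V. (x, u) \<notin> linked S \<and> (x, v) \<notin> linked S})"
    unfolding components_def component_insert[abs_def] by simp
  also have "component S ` {x \<in> V. (x, u) \<notin> linked S \<and> (x, v) \<notin> linked S}
    = components V S - {component S u, component S v}"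
    unfolding components_def set_eq_iff[of "image _ _"] Diff_iff insert_iff empty_iff image_iff mem_Collect_eq Bex_def
    by (metis component_eq_iff)
  finally show ?thesis .
qed

lemma components_disjoint:
  assumes "C \<in> components V S" "D \<in> components V S" "C \<noteq> D"
  shows "C \<inter> D = {}"
proof (rule ccontr)
  assume "C \<inter> D \<noteq> {}"
  then obtain z where "z \<in> C" "z \<in> D" by blast
  moreover obtain x y where "C = component S x" "D = component S y"
    using assms by (auto simp: components_def)
  ultimately have "C = component S z" "D = component S z" by (auto simp: component_eq_iff linked_sym)
  then show False using assms(3) by simp
qed

locale simple_graph =
  fixes V :: "'a set" and E :: "'a set set"
  assumes finite_V [simp]: "finite V"
    and edgeE: "e \<in> E \<Longrightarrow> \<exists>u\<in>V. \<exists>v\<in>V. u \<noteq> v \<and> e = {u, v}"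
begin

lemma finite_E [simp]: "finite E"
proof (rule finite_subset)
  show "E \<subseteq> Pow V" using edgeE by blast
qed simp

lemma edge_in_V: "{u, v} \<in> E \<Longrightarrow> u \<in> V \<and> v \<in> V"
  using edgeE[of "{u, v}"] by (auto simp: doubleton_eq_iff)

lemma edge_neq: "{u, v} \<in> E \<Longrightarrow> u \<noteq> v"
  using edgeE[of "{u, v}"] by (auto simp: doubleton_eq_iff)

lemma linked_in_V:
  assumes "(x, y) \<in> linked S" "S \<subseteq> E" "x \<in> V"
  shows "y \<in> V"
  using assms unfolding linked_def
  by (induction rule: rtrancl_induct) (auto simp: arcs_of_def dest: edge_in_V)

lemma component_subset: "S \<subseteq> E \<Longrightarrow> x \<in> V \<Longrightarrow> component S x \<subseteq> V"
  using linked_in_V by auto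

lemma finite_component [simp]: "S \<subseteq> E \<Longrightarrow> x \<in> V \<Longrightarrow> finite (component S x)"
  using component_subset finite_V by (meson finite_subset)

lemma finite_components [simp]: "finite (components V S)"
  by (simp add: components_def)

lemma component_in [simp]: "x \<in> V \<Longrightarrow> component S x \<in> components V S"
  by (simp add: components_def)

lemma card_components_pos:
  assumes "S \<subseteq> E" "C \<in> components V S"
  shows "card C > 0"
proof -
  from assms(2) obtain x where x: "x \<in> V" "C = component S x" by (auto simp: components_def)
  then show ?thesis using assms(1) by (simp add: card_gt_0_iff)
qed

lemma size_comp_sizes: "size (comp_sizes V S) = card (components V S)"
  by (simp add: comp_sizes_def)

lemma count_comp_sizes: "count (comp_sizes V S) a = card {C \<in> components V S. card C = a}"
  unfolding comp_sizes_def by (rule count_image_mset_set) simp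

lemma comp_sizes_pos: "S \<subseteq> E \<Longrightarrow> 0 \<notin># comp_sizes V S"
  using card_components_pos[of S] by (auto simp: comp_sizes_def) (metis less_irrefl)

lemma sum_comp_sizes:
  assumes "S \<subseteq> E"
  shows "sum_mset (comp_sizes V S) = card V"
proof -
  have "sum_mset (comp_sizes V S) = (\<Sum>C\<in>components V S. card C)"
    by (simp add: comp_sizes_def sum_unfold_sum_mset)
  also have "\<dots> = card (\<Union>(components V S))"
  proof (rule card_Union_disjoint[symmetric])
    show "pairwise disjnt (components V S)"
      unfolding pairwise_def disjnt_def using components_disjoint[of _ V S] by metis
    show "finite C" if "C \<in> components V S" for C
      using that assms by (auto simp: components_def)
  qed
  also have "\<Union>(components V S) = V"
    using linked_in_V[OF _ assms] linked_refl by (force simp: components_def)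
  finally show ?thesis .
qed

text \<open>
  Adding an edge between different components merges them. The sizes of the merged components
  are added on the left because subtraction of multisets is truncated.
\<close>

lemma comp_sizes_insert:
  assumes S: "S \<subseteq> E" and uv: "u \<in> V" "v \<in> V" and nl: "(u, v) \<notin> linked S"
  shows "comp_sizes V (insert {u, v} S) + {#card (component S u), card (component S v)#} =
    add_mset (card (component S u) + card (component S v)) (comp_sizes V S)"
proof -
  let ?U = "component S u" and ?W = "component S v"
  let ?R = "components V S - {?U, ?W}"
  have neq: "?U \<noteq> ?W" using nl by (simp add: component_eq_iff)
  have dis: "?U \<inter> ?W = {}" using components_disjoint[of ?U V S ?W] uv neq by simp
  have cU: "card (?U \<union> ?W) = card ?U + card ?W"
    using dis S uv by (intro card_Un_disjoint) auto
  have new: "?U \<union> ?W \<notin> ?R"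
  proof
    assume "?U \<union> ?W \<in> ?R"
    then have "(?U \<union> ?W) \<inter> ?U = {}"
      using uv by (intro components_disjoint[of _ V S]) auto
    moreover have "u \<in> (?U \<union> ?W) \<inter> ?U" by simp
    ultimately show False by blast
  qed
  have 1: "comp_sizes V (insert {u, v} S) = add_mset (card ?U + card ?W) (image_mset card (mset_set ?R))"
    unfolding comp_sizes_def components_insert[OF uv] using new by (simp add: cU)
  have "components V S = insert ?U (insert ?W ?R)" using uv by auto
  then have "comp_sizes V S = image_mset card (mset_set (insert ?U (insert ?W ?R)))"
    by (simp add: comp_sizes_def)
  also have "\<dots> = image_mset card (mset_set ?R) + {#card ?U, card ?W#}"
    using neq by (subst mset_set.insert | simp)+
  finally show ?thesis using 1 by simp
qed

end

locale forest_graph = simple_graph +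
  assumes bridge: "{u, v} \<in> E \<Longrightarrow> (u, v) \<notin> linked (E - {{u, v}})"
begin

text \<open>
  In a forest every new edge joins two components. This is what makes the sign
  \<open>(-1)^|S|\<close> a function of the number of components.
\<close>

lemma forest_size_comp_sizes:
  assumes "S \<subseteq> E"
  shows "size (comp_sizes V S) + card S = card V"
proof -
  have "finite S" using assms finite_subset finite_E by blast
  then show ?thesis using assms
  proof induction
    case empty
    have "linked ({} :: 'a set set) = Id" by (simp add: linked_def arcs_of_def)
    then have "component ({} :: 'a set set) = (\<lambda>x. {x})" by (auto simp: component_def)
    then show ?case by (simp add: size_comp_sizes components_def card_image)
  next
    case (insert e S)
    obtain u v where e: "e = {u, v}" "u \<in> V" "v \<in> V" using insert.prems edgeE[of e] by blast
    have "(u, v) \<notin> linked S"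
      using bridge[of u v] insert e linked_mono[of S "E - {{u, v}}"] by blast
    then have "size (comp_sizes V (insert {u, v} S)
        + {#card (component S u), card (component S v)#})
      = size (add_mset (card (component S u) + card (component S v)) (comp_sizes V S))"
      using insert.prems e by (subst comp_sizes_insert) auto
    then show ?case using insert e by simp
  qed
qed

end

section \<open>The power-sum expansion of the chromatic symmetric function\<close>

definition edges_of :: "'a pair_pre_digraph \<Rightarrow> 'a set set" where
  "edges_of G = {{u, v} | u v. (u, v) \<in> parcs G}"

lemma pair_graph_sym: "pair_graph G \<Longrightarrow> (u, v) \<in> parcs G \<longleftrightarrow> (v, u) \<in> parcs G"
  by (metis pair_graph.axioms(2) pair_pseudo_graph.axioms(2) pair_sym_digraph.arcs_symmetric)

lemma edge_iff_arc: "pair_graph G \<Longrightarrow> {u, v} \<in> edges_of G \<longleftrightarrow> (u, v) \<in> parcs G"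
  using pair_graph_sym[of G] by (auto simp: edges_of_def doubleton_eq_iff)

lemma pair_graph_simple_graph:
  assumes "pair_graph G"
  shows "simple_graph (pverts G) (edges_of G)"
proof -
  interpret pair_graph G by fact
  show ?thesis
  proof
    show "finite (pverts G)" by (rule pair_finite_verts)
    fix e assume "e \<in> edges_of G"
    then obtain u v where "(u, v) \<in> parcs G" "e = {u, v}" by (auto simp: edges_of_def)
    then show "\<exists>u\<in>pverts G. \<exists>v\<in>pverts G. u \<noteq> v \<and> e = {u, v}"
      using no_loops' wellformed' by blast
  qed
qed

context simple_graph
begin

definition monochromatic :: "('a \<Rightarrow> nat) \<Rightarrow> 'a set set \<Rightarrow> bool" where
  "monochromatic \<kappa> S \<longleftrightarrow> (\<forall>u v. {u, v} \<in> S \<longrightarrow> \<kappa> u = \<kappa> v)"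

text \<open>
  A coloring that is constant along the edges of \<open>S\<close> is a coloring of the components of
  \<open>S\<close>, in which the color of a component of size \<open>r\<close> contributes an \<open>r\<close>-th power.
\<close>

lemma card_monochromatic_colorings:
  assumes "S \<subseteq> E"
  shows "card {\<kappa> \<in> placements V (\<lambda>_. 1) m. monochromatic \<kappa> S} = card (placements (components V S) card m)"
proof (rule bij_betw_same_card[symmetric], rule bij_betw_imageI)
  let ?h = "\<lambda>f. \<lambda>v\<in>V. f (component S v)"
  have wt: "(\<Sum>v\<in>V. Poly_Mapping.single (?h f v) 1)
      = (\<Sum>C\<in>components V S. Poly_Mapping.single (f C) (card C))" for f :: "'a set \<Rightarrow> nat"
  proof -
    have "(\<Sum>v\<in>V. Poly_Mapping.single (?h f v) 1)
        = (\<Sum>v\<in>V. Poly_Mapping.single (f (component S v)) (1::nat))"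
      by (intro sum.cong) auto
    also have "\<dots> = (\<Sum>C\<in>components V S. \<Sum>v | v \<in> V \<and> component S v = C.
        Poly_Mapping.single (f (component S v)) 1)"
      unfolding components_def by (rule sum.image_gen) simp
    also have "\<dots> = (\<Sum>C\<in>components V S. Poly_Mapping.single (f C) (card C))"
    proof (rule sum.cong[OF refl])
      fix C assume "C \<in> components V S"
      then obtain x where x: "x \<in> V" "C = component S x" by (auto simp: components_def)
      have "{v \<in> V. component S v = C} = C"
        unfolding x using linked_in_V[OF _ assms x(1)] by (auto simp: component_eq_iff linked_sym)
      moreover have "(\<Sum>v\<in>D. Poly_Mapping.single a (1::nat)) = Poly_Mapping.single a (card D)" for a :: nat and D :: "'a set"
        by (induction D rule: infinite_finite_induct) (simp_all add: single_add[symmetric] del: sum_constant)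
      moreover have "(\<Sum>v | v \<in> V \<and> component S v = C. Poly_Mapping.single (f (component S v)) (1::nat))
          = (\<Sum>v | v \<in> V \<and> component S v = C. Poly_Mapping.single (f C) 1)"
        by (intro sum.cong) auto
      ultimately show "(\<Sum>v | v \<in> V \<and> component S v = C. Poly_Mapping.single (f (component S v)) 1)
          = Poly_Mapping.single (f C) (card C)" by metis
    qed
    finally show ?thesis .
  qed
  show "inj_on ?h (placements (components V S) card m)"
  proof (rule inj_onI)
    fix f g assume f: "f \<in> placements (components V S) card m"
      and g: "g \<in> placements (components V S) card m" and e: "?h f = ?h g"
    show "f = g"
    proof (rule PiE_ext)
      show "f \<in> components V S \<rightarrow>\<^sub>E {1..}" "g \<in> components V S \<rightarrow>\<^sub>E {1..}"
        using f g by (auto simp: placements_def)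
      fix C assume "C \<in> components V S"
      then obtain x where x: "x \<in> V" "C = component S x" by (auto simp: components_def)
      then show "f C = g C" using fun_cong[OF e, of x] by simp
    qed
  qed
  show "?h ` placements (components V S) card m
      = {\<kappa> \<in> placements V (\<lambda>_. 1) m. monochromatic \<kappa> S}"
  proof (intro equalityI subsetI)
    fix \<kappa> assume "\<kappa> \<in> ?h ` placements (components V S) card m"
    then obtain f where f: "f \<in> placements (components V S) card m" "\<kappa> = ?h f" by blast
    have "monochromatic \<kappa> S"
      unfolding monochromatic_def
    proof (intro allI impI)
      fix u v assume uv: "{u, v} \<in> S"
      then have "component S u = component S v" "u \<in> V" "v \<in> V"
        using assms edge_in_V by (auto simp: component_eq_iff linked_edge simp del: mem_component)
      then show "\<kappa> u = \<kappa> v" using f by simp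
    qed
    moreover have "\<kappa> \<in> placements V (\<lambda>_. 1) m"
      using f wt[of f] by (auto simp: placements_def PiE_iff)
    ultimately show "\<kappa> \<in> {\<kappa> \<in> placements V (\<lambda>_. 1) m. monochromatic \<kappa> S}" by simp
  next
    fix \<kappa> assume \<kappa>: "\<kappa> \<in> {\<kappa> \<in> placements V (\<lambda>_. 1) m. monochromatic \<kappa> S}"
    define f where "f = (\<lambda>C\<in>components V S. \<kappa> (SOME x. x \<in> C))"
    have fv: "f (component S v) = \<kappa> v" if "v \<in> V" for v
    proof -
      have "(v, SOME x. x \<in> component S v) \<in> linked S"
        using someI[of "\<lambda>x. x \<in> component S v" v] by simp
      then have "\<kappa> v = \<kappa> (SOME x. x \<in> component S v)"
        by (rule linked_invariant) (use \<kappa> in \<open>simp add: monochromatic_def\<close>)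
      then show ?thesis using that by (simp add: f_def)
    qed
    have "\<kappa> v = undefined" if "v \<notin> V" for v
      using \<kappa> that by (auto simp: placements_def PiE_iff extensional_def)
    then have h: "?h f = \<kappa>" using fv by (auto simp: fun_eq_iff restrict_def)
    have "f \<in> components V S \<rightarrow>\<^sub>E {1..}"
      using fv \<kappa> by (auto simp: PiE_iff components_def placements_def f_def)
    then have "f \<in> placements (components V S) card m"
      using \<kappa> wt[of f] unfolding h by (auto simp: placements_def)
    then show "\<kappa> \<in> ?h ` placements (components V S) card m" using h by blast
  qed
qed

text \<open>
  Inclusion-exclusion over the set of monochromatic edges: the alternating sum of the
  sets \<open>S\<close> on which a coloring is monochromatic is \<open>1\<close> for a proper coloring and \<open>0\<close>
  otherwise.
\<close>

lemma card_proper_colorings: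
  "of_nat (card {\<kappa> \<in> placements V (\<lambda>_. 1) m. \<forall>u v. {u, v} \<in> E \<longrightarrow> \<kappa> u \<noteq> \<kappa> v})
    = (\<Sum>S\<in>Pow E. (-1 :: rat) ^ card S * of_nat (card (placements (components V S) card m)))"
proof -
  let ?K = "placements V (\<lambda>_. 1) m"
  have fin: "finite ?K" by (rule finite_placements) auto
  have mono_iff: "monochromatic \<kappa> S \<longleftrightarrow> S \<subseteq> {e\<in>E. monochromatic \<kappa> {e}}" if "S \<subseteq> E" for \<kappa> S
    using that edgeE by (auto simp: monochromatic_def) 
  have sieve: "(\<Sum>S | S \<in> Pow E \<and> monochromatic \<kappa> S. (-1 :: rat) ^ card S)
      = (if \<forall>u v. {u, v} \<in> E \<longrightarrow> \<kappa> u \<noteq> \<kappa> v then 1 else 0)" for \<kappa>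
  proof -
    let ?M = "{e\<in>E. monochromatic \<kappa> {e}}"
    have "{S. S \<in> Pow E \<and> monochromatic \<kappa> S} = Pow ?M" using mono_iff by blast
    moreover have "(\<Sum>S\<in>Pow ?M. (-1 :: rat) ^ card S) = (\<Prod>e\<in>?M. -1 + 1)"
      by (subst prod_add) auto
    moreover have "?M = {} \<longleftrightarrow> (\<forall>u v. {u, v} \<in> E \<longrightarrow> \<kappa> u \<noteq> \<kappa> v)"
    proof
      assume "?M = {}"
      show "\<forall>u v. {u, v} \<in> E \<longrightarrow> \<kappa> u \<noteq> \<kappa> v"
      proof (intro allI impI notI)
        fix u v assume "{u, v} \<in> E" "\<kappa> u = \<kappa> v"
        then have "{u, v} \<in> ?M" by (auto simp: monochromatic_def doubleton_eq_iff)
        then show False using \<open>?M = {}\<close> by blast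
      qed
    next
      assume *: "\<forall>u v. {u, v} \<in> E \<longrightarrow> \<kappa> u \<noteq> \<kappa> v"
      show "?M = {}"
      proof (rule ccontr)
        assume "?M \<noteq> {}"
        then obtain e where e: "e \<in> E" "monochromatic \<kappa> {e}" by blast
        then obtain u v where "e = {u, v}" using edgeE by blast
        then show False using e * by (auto simp: monochromatic_def)
      qed
    qed
    moreover have "finite ?M" by simp
    ultimately show ?thesis by (simp add: card_eq_0_iff power_0_left)
  qed
  have "of_nat (card {\<kappa> \<in> ?K. \<forall>u v. {u, v} \<in> E \<longrightarrow> \<kappa> u \<noteq> \<kappa> v})
      = (\<Sum>\<kappa>\<in>?K. if \<forall>u v. {u, v} \<in> E \<longrightarrow> \<kappa> u \<noteq> \<kappa> v then 1 else (0::rat))"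
    using fin by (simp add: sum.If_cases Int_def)
  also have "\<dots> = (\<Sum>\<kappa>\<in>?K. \<Sum>S | S \<in> Pow E \<and> monochromatic \<kappa> S. (-1 :: rat) ^ card S)"
    by (simp only: sieve)
  also have "\<dots> = (\<Sum>S\<in>Pow E. \<Sum>\<kappa> | \<kappa> \<in> ?K \<and> monochromatic \<kappa> S. (-1 :: rat) ^ card S)"
    using fin by (intro sum.swap_restrict) auto
  also have "\<dots> = (\<Sum>S\<in>Pow E. (-1 :: rat) ^ card S * of_nat (card (placements (components V S) card m)))"
    by (intro sum.cong refl) (simp add: card_monochromatic_colorings[symmetric] mult.commute)
  finally show ?thesis .
qed

end

definition subset_expansion :: "'a set \<Rightarrow> 'a set set \<Rightarrow> ppoly" where
  "subset_expansion V E =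
    (\<Sum>S\<in>Pow E. Poly_Mapping.single (mono_of_mset (comp_sizes V S)) ((-1) ^ card S))"

text \<open>
  Both sides have the same expansion in the variables, and the power sums are algebraically
  independent.
\<close>

lemma chromatic_ppoly_eq:
  assumes G: "pair_graph G"
  shows "chromatic_ppoly G = subset_expansion (pverts G) (edges_of G)"
  unfolding chromatic_ppoly_def
proof (rule the_equality)
  let ?V = "pverts G" and ?E = "edges_of G"
  let ?P = "subset_expansion ?V ?E"
  interpret simple_graph ?V ?E by (rule pair_graph_simple_graph[OF G])
  have keys: "Poly_Mapping.keys ?P \<subseteq> mono_of_mset ` comp_sizes ?V ` Pow ?E"
    unfolding subset_expansion_def
    by (rule order_trans[OF keys_sum]) (auto split: if_splits)
  have ring: "?P \<in> power_sum_ring"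
    unfolding power_sum_ring_def
  proof (intro CollectI ballI)
    fix \<mu> assume "\<mu> \<in> Poly_Mapping.keys ?P"
    then obtain S where "S \<subseteq> ?E" "\<mu> = mono_of_mset (comp_sizes ?V S)" using keys by blast
    then show "0 \<notin> Poly_Mapping.keys \<mu>" using comp_sizes_pos by simp
  qed
  have "ppoly_subst xconst power_sum ?P
    = (\<Sum>S\<in>Pow ?E. xconst ((-1) ^ card S) * (\<Prod>r\<in>#comp_sizes ?V S. power_sum r))"
    unfolding subset_expansion_def
    by (simp add: ppoly_subst_sum ppoly_subst_single xconst_0 xconst_add)
  also have "\<dots> = chromatic_sym G"
  proof (rule xseries_eqI)
    fix m
    have "xcoeff (\<Sum>S\<in>Pow ?E. xconst ((-1) ^ card S) * (\<Prod>r\<in>#comp_sizes ?V S. power_sum r)) m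
      = (\<Sum>S\<in>Pow ?E. (-1) ^ card S * xcoeff (\<Prod>C\<in>components ?V S. power_sum (card C)) m)"
      by (simp add: xcoeff_sum xcoeff_xconst_mult comp_sizes_def prod_unfold_prod_mset
          image_mset.compositionality comp_def)
    also have "\<dots> = (\<Sum>S\<in>Pow ?E. (-1) ^ card S * of_nat (card (placements (components ?V S) card m)))"
      using card_components_pos
      by (intro sum.cong refl arg_cong2[where f = times] xcoeff_prod_power_sum) auto
    also have "\<dots> = of_nat (card {\<kappa> \<in> placements ?V (\<lambda>_. 1) m. \<forall>u v. {u, v} \<in> ?E \<longrightarrow> \<kappa> u \<noteq> \<kappa> v})"
      by (rule card_proper_colorings[symmetric])
    also have "{\<kappa> \<in> placements ?V (\<lambda>_. 1) m. \<forall>u v. {u, v} \<in> ?E \<longrightarrow> \<kappa> u \<noteq> \<kappa> v}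
      = {\<kappa> \<in> proper_colorings G. (\<Sum>v\<in>?V. Poly_Mapping.single (\<kappa> v) 1) = m}"
      by (auto simp: placements_def proper_colorings_def edge_iff_arc[OF G])
    finally show "xcoeff (\<Sum>S\<in>Pow ?E. xconst ((-1) ^ card S) * (\<Prod>r\<in>#comp_sizes ?V S. power_sum r)) m
        = xcoeff (chromatic_sym G) m"
      by (simp add: chromatic_sym.rep_eq)
  qed
  finally show P: "?P \<in> power_sum_ring \<and> ppoly_subst xconst power_sum ?P = chromatic_sym G"
    using ring by simp
  fix Q assume Q: "Q \<in> power_sum_ring \<and> ppoly_subst xconst power_sum Q = chromatic_sym G"
  \<comment> \<open>Substitution is additive, so two candidates differ by a polynomial relation between power sums.\<close>
  have "ppoly_subst xconst power_sum (Q + (?P - Q)) = ppoly_subst xconst power_sum Q + ppoly_subst xconst power_sum (?P - Q)"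
    by (rule ppoly_subst_add) (simp_all add: xconst_0 xconst_add)
  then have "ppoly_subst xconst power_sum (?P - Q) = 0" using P Q by simp
  moreover have "?P - Q \<in> power_sum_ring"
    using P Q keys_diff[of ?P Q] unfolding power_sum_ring_def by blast
  ultimately have "?P - Q = 0" by (intro power_sums_algebraically_independent)
  then show "Q = ?P" by simp
qed

lemma lookup_ppoly_pderiv:
  "Poly_Mapping.lookup (ppoly_pderiv r P) (mono_of_mset N)
    = of_nat (count N r + 1) * Poly_Mapping.lookup P (mono_of_mset (add_mset r N))"
proof -
  let ?t = "\<lambda>\<mu>. Poly_Mapping.single (\<mu> - Poly_Mapping.single r 1)
        (of_nat (Poly_Mapping.lookup \<mu> r) * Poly_Mapping.lookup P \<mu>)"
  have t: "Poly_Mapping.lookup (?t \<mu>) (mono_of_mset N) = (if \<mu> = mono_of_mset (add_mset r N)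
      then of_nat (count N r + 1) * Poly_Mapping.lookup P (mono_of_mset (add_mset r N)) else 0)" for \<mu>
  proof -
    obtain M where M: "\<mu> = mono_of_mset M" by (rule mono_of_mset_cases)
    show ?thesis
    proof (cases "r \<in># M")
      case True
      then obtain M' where M': "M = add_mset r M'" by (auto dest: multi_member_split)
      have "\<mu> - Poly_Mapping.single r 1 = mono_of_mset M'" by (simp add: M M')
      then show ?thesis by (simp add: M M' lookup_single when_def del: mono_of_mset_add)
    next
      case False
      then show ?thesis by (auto simp: M not_in_iff lookup_single simp del: mono_of_mset_add)
    qed
  qed
  have "Poly_Mapping.lookup (ppoly_pderiv r P) (mono_of_mset N)
      = (\<Sum>\<mu>\<in>Poly_Mapping.keys P. Poly_Mapping.lookup (?t \<mu>) (mono_of_mset N))"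
    unfolding ppoly_pderiv_def lookup_sum ..
  then show ?thesis unfolding t by (auto simp: sum.delta in_keys_iff)
qed

lemma lookup_ppoly_set_zero:
  "Poly_Mapping.lookup (ppoly_set_zero r P) (mono_of_mset N)
    = (if r \<in># N then 0 else Poly_Mapping.lookup P (mono_of_mset N))"
proof -
  let ?f = "\<lambda>s. if s = r then 0 else ppoly_var s"
  have "(\<Prod>s\<in>Poly_Mapping.keys \<mu>. ?f s ^ Poly_Mapping.lookup \<mu> s)
    = (if r \<in> Poly_Mapping.keys \<mu> then 0 else Poly_Mapping.single \<mu> 1)" for \<mu>
  proof -
    obtain M where M: "\<mu> = mono_of_mset M" by (rule mono_of_mset_cases)
    have "(\<Prod>s\<in>#M. ?f s) = (if r \<in># M then 0 else Poly_Mapping.single (mono_of_mset M) 1)"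
      by (induction M) (auto simp: ppoly_var_def mult_single)
    then show ?thesis by (simp add: M image_prod_mset_multiplicity)
  qed
  then have "Poly_Mapping.lookup (ppoly_set_zero r P) (mono_of_mset N) = (\<Sum>\<mu>\<in>Poly_Mapping.keys P.
     if \<mu> = mono_of_mset N then (if r \<in># N then 0 else Poly_Mapping.lookup P (mono_of_mset N)) else 0)"
    unfolding ppoly_set_zero_def ppoly_subst_def lookup_sum
    by (intro sum.cong) (auto simp: mult_single lookup_single when_def)
  then show ?thesis by (auto simp: sum.delta in_keys_iff)
qed

text \<open>
  Only the monomials in which \<open>p_1\<close> occurs exactly once survive, and they do so with factor
  one.
\<close>

lemma lookup_Phi:
  assumes "pair_graph G"
  shows "Poly_Mapping.lookup (Phi G) (mono_of_mset N) = (if 1 \<in># N then 0 else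
    (\<Sum>S | S \<subseteq> edges_of G \<and> comp_sizes (pverts G) S = add_mset 1 N. (-1) ^ card S))"
proof -
  have fin: "finite (edges_of G)"
    using pair_graph_simple_graph[OF assms] by (rule simple_graph.finite_E)
  have "Poly_Mapping.lookup (subset_expansion (pverts G) (edges_of G)) (mono_of_mset M)
    = (\<Sum>S\<in>Pow (edges_of G). if comp_sizes (pverts G) S = M then (-1) ^ card S else 0)" for M
    unfolding subset_expansion_def lookup_sum by (intro sum.cong) (auto simp: lookup_single when_def)
  also have "\<dots> M = (\<Sum>S | S \<subseteq> edges_of G \<and> comp_sizes (pverts G) S = M. (-1) ^ card S)" for M
    using fin by (simp add: sum.If_cases Int_def)
  finally have lookup: "Poly_Mapping.lookup (subset_expansion (pverts G) (edges_of G)) (mono_of_mset M)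
    = (\<Sum>S | S \<subseteq> edges_of G \<and> comp_sizes (pverts G) S = M. (-1) ^ card S)" for M .
  show ?thesis
    unfolding Phi_def chromatic_ppoly_eq[OF assms] lookup_ppoly_set_zero lookup_ppoly_pderiv lookup
    by (auto simp: count_eq_zero_iff)
qed

section \<open>Weight multisets recovered from removals\<close>

text \<open>
  A triangular system of linear equations for the multiplicities: if \<open>G p q\<close> vanishes unless
  \<open>q = p\<close> or \<open>q\<close> has smaller rank, and the diagonal is nonzero, then the values
  \<open>\<Sum>q. G p q\<close> determine the multiset, by induction on the rank.
\<close>

lemma multiset_eq_triangular:
  fixes s :: "'p \<Rightarrow> nat" and G :: "'p \<Rightarrow> 'p \<Rightarrow> nat"
  assumes tri: "\<And>p q. p \<in># X + Y \<Longrightarrow> q \<in># X + Y \<Longrightarrow> G p q \<noteq> 0 \<Longrightarrow> q = p \<or> s q < s p"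
    and diag: "\<And>p. p \<in># X + Y \<Longrightarrow> G p p \<noteq> 0"
    and eq: "\<And>p. p \<in># X + Y \<Longrightarrow> (\<Sum>q\<in>#X. G p q) = (\<Sum>q\<in>#Y. G p q)"
  shows "X = Y"
proof (rule multiset_eqI)
  let ?Z = "set_mset (X + Y)"
  have expand: "(\<Sum>q\<in>#W. g q) = (\<Sum>q\<in>?Z. count W q * g q)" if "set_mset W \<subseteq> ?Z" for W and g :: "'p \<Rightarrow> nat"
    using that
  proof (induction W)
    case (add x W)
    have "(\<Sum>q\<in>?Z. count (add_mset x W) q * g q)
        = (\<Sum>q\<in>?Z. (if q = x then g q else 0) + count W q * g q)"
      by (intro sum.cong) auto
    also have "\<dots> = g x + (\<Sum>q\<in>?Z. count W q * g q)"
      using add.prems by (simp add: sum.distrib)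
    finally show ?case using add by simp
  qed simp
  fix p show "count X p = count Y p"
  proof (induction "s p" arbitrary: p rule: less_induct)
    case less
    show ?case
    proof (cases "p \<in> ?Z")
      case True
      have split: "(\<Sum>q\<in>#W. G p q) = count W p * G p p + (\<Sum>q\<in>?Z - {p}. count W q * G p q)"
        if "set_mset W \<subseteq> ?Z" for W
        unfolding expand[OF that] using True by (intro sum.remove) auto
      have "(\<Sum>q\<in>?Z - {p}. count X q * G p q) = (\<Sum>q\<in>?Z - {p}. count Y q * G p q)"
        using tri[OF True] less by (intro sum.cong refl) (metis DiffE insertI1 mult_0_right)
      then have "count X p * G p p = count Y p * G p p"
        using eq[OF True] split[of X] split[of Y] by simp
      then show ?thesis using diag[OF True] by simp
    next
      case False
      then show ?thesis by (simp add: not_in_iff)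
    qed
  qed
qed

text \<open>
  If \<open>M\<close> is the weight multiset of a skeleton, a vertex of weight \<open>x\<close> carries \<open>x - 1\<close>
  leaves, and isolating one of them lowers \<open>x\<close> by one. All resulting multisets are
  collected, one for each leaf.
\<close>

definition leaf_removals :: "nat multiset \<Rightarrow> nat multiset multiset" where
  "leaf_removals M = (\<Sum>x\<in>#M. replicate_mset (x - 1) (add_mset (x - 1) (M - {#x#})))"

lemma mem_sum_mset: "N \<in># sum_mset A \<longleftrightarrow> (\<exists>B\<in>#A. N \<in># B)"
  by blast

lemma mem_leaf_removals:
  "N \<in># leaf_removals M \<longleftrightarrow> (\<exists>x\<in>#M. x > 1 \<and> N = add_mset (x - 1) (M - {#x#}))"
  by (simp add: leaf_removals_def mem_sum_mset in_replicate_mset)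
    (auto simp: Bex_def)

lemma filter_mset_sum_mset: "filter_mset P (\<Sum>x\<in>#A. f x) = (\<Sum>x\<in>#A. filter_mset P (f x))"
  by (induction A) auto

lemma count_sum_mset: "count (\<Sum>x\<in>#A. f x) y = (\<Sum>x\<in>#A. count (f x) y)"
  by (induction A) auto

lemma filter_replicate:
  "filter_mset P (replicate_mset n y) = (if P y then replicate_mset n y else {#})"
  by (induction n) auto

text \<open>
  Setting \<open>p_1 = 0\<close> hides exactly the leaves at vertices of weight \<open>2\<close>, of which there is one
  for each such vertex. The number of visible removals therefore tells how often the weight
  \<open>2\<close> occurs.
\<close>

lemma size_leaf_removals:
  assumes "\<And>x. x \<in># M \<Longrightarrow> x \<ge> 2"
  shows "size (filter_mset (\<lambda>N. 1 \<notin># N) (leaf_removals M)) + count M 2 + size M = sum_mset M"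
proof -
  have rep: "size (filter_mset (\<lambda>N. 1 \<notin># N) (replicate_mset (x - 1) (add_mset (x - 1) (M - {#x#}))))
      = (if x = 2 then 0 else x - 1)" if "x \<in># M" for x
  proof -
    have "1 \<notin># M - {#x#}" using assms[of 1] by (auto dest: in_diffD)
    then show ?thesis using assms[OF that] by (auto simp: filter_replicate)
  qed
  have "size (filter_mset (\<lambda>N. 1 \<notin># N) (leaf_removals M))
      = (\<Sum>x\<in>#M. if x = 2 then 0 else x - 1)"
    unfolding leaf_removals_def filter_mset_sum_mset size_mset_sum_mset_conv image_mset.compositionality comp_def
    by (intro arg_cong[of _ _ sum_mset] image_mset_cong) (rule rep)
  moreover have "(\<Sum>x\<in>#M. if x = 2 then 0 else x - 1) + count M 2 + size M = sum_mset M"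
    using assms
  proof (induction M)
    case (add x M)
    have "x \<ge> 2" using add.prems by simp
    moreover have "(\<Sum>x\<in>#M. if x = 2 then 0 else x - 1) + count M 2 + size M = sum_mset M"
      using add by simp
    ultimately show ?case by auto
  qed simp
  ultimately show ?thesis by simp
qed

text \<open>
  Let \<open>b\<close> be the least weight above \<open>2\<close> in the two multisets. Lowering \<open>b\<close> in \<open>M\<close>
  creates a part that is below \<open>b\<close> in addition to the twos. The same multiset has to arise from
  \<open>M'\<close>, which has as many twos and nothing else below \<open>b\<close>, so there the lowered part must
  be \<open>b\<close> as well.
\<close>

lemma weights_from_leaf_removals_least:
  assumes M: "\<And>x. x \<in># M \<Longrightarrow> x \<ge> 2" and M': "\<And>x. x \<in># M' \<Longrightarrow> x \<ge> 2"
    and twos: "count M 2 = count M' 2"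
    and eq: "filter_mset (\<lambda>N. 1 \<notin># N) (leaf_removals M) = filter_mset (\<lambda>N. 1 \<notin># N) (leaf_removals M')"
    and b: "b \<in># M" "b \<ge> 3" and min: "\<And>x. x \<in># M + M' \<Longrightarrow> x \<ge> 3 \<Longrightarrow> b \<le> x"
  shows "M = M'"
proof -
  let ?N = "add_mset (b - 1) (M - {#b#})"
  have "1 \<notin># ?N" using M b by (auto dest!: in_diffD) force
  moreover have "?N \<in># leaf_removals M"
    unfolding mem_leaf_removals using b by (intro bexI[of _ b]) auto
  ultimately have "?N \<in># leaf_removals M'" using eq by (metis (mono_tags, lifting) mem_Collect_eq set_mset_filter)
  then obtain c where c: "c \<in># M'" "c > 1" and N: "?N = add_mset (c - 1) (M' - {#c#})"
    by (auto simp: mem_leaf_removals)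
  have "c \<noteq> 2" using N \<open>1 \<notin># ?N\<close> by auto
  then have "c \<ge> b" using c min[of c] by auto
  have small: "filter_mset (\<lambda>x. x < b) W = replicate_mset (count W 2) 2"
    if "\<And>x. x \<in># W \<Longrightarrow> x \<ge> 2" "\<And>x. x \<in># W \<Longrightarrow> x \<ge> 3 \<Longrightarrow> b \<le> x" for W
  proof -
    have "filter_mset (\<lambda>x. x < b) W = filter_mset (\<lambda>x. x = 2) W"
      using that b by (intro filter_mset_cong refl) force
    then show ?thesis by (simp add: filter_eq_replicate_mset)
  qed
  have "filter_mset (\<lambda>x. x < b) ?N = add_mset (b - 1) (replicate_mset (count M 2) 2)"
    using small[of M] M min b by (auto simp: filter_diff_mset)
  moreover have "filter_mset (\<lambda>x. x < b) ?N
      = (if c - 1 < b then {#c - 1#} else {#}) + replicate_mset (count M' 2) 2"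
    unfolding N using small[of M'] M' min \<open>c \<ge> b\<close> by (auto simp: filter_diff_mset)
  ultimately have "size ((if c - 1 < b then {#c - 1#} else {#}) + replicate_mset (count M' 2) 2)
      = size (add_mset (b - 1) (replicate_mset (count M 2) 2))" by simp
  then have "c - 1 < b" using twos by (auto split: if_splits)
  then have "c = b" using \<open>c \<ge> b\<close> c by auto
  then have "M - {#b#} = M' - {#b#}" using N by simp
  then show ?thesis using b(1) c(1) \<open>c = b\<close> by (metis insert_DiffM)
qed

lemma weights_from_leaf_removals:
  assumes M: "\<And>x. x \<in># M \<Longrightarrow> x \<ge> 2" and M': "\<And>x. x \<in># M' \<Longrightarrow> x \<ge> 2"
    and size: "size M = size M'" and sum: "sum_mset M = sum_mset M'"
    and eq: "filter_mset (\<lambda>N. 1 \<notin># N) (leaf_removals M) = filter_mset (\<lambda>N. 1 \<notin># N) (leaf_removals M')"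
  shows "M = M'"
proof (cases "\<exists>x\<in>#M + M'. x \<ge> 3")
  case True
  define b where "b = (LEAST x. x \<in># M + M' \<and> x \<ge> 3)"
  have b: "b \<in># M + M' \<and> b \<ge> 3"
    unfolding b_def by (rule LeastI_ex) (use True in blast)
  have min: "b \<le> x" if "x \<in># M + M'" "x \<ge> 3" for x
    unfolding b_def using that by (intro Least_le) simp
  have twos: "count M 2 = count M' 2"
    using size_leaf_removals[of M, OF M] size_leaf_removals[of M', OF M'] size sum
    unfolding eq by linarith
  show ?thesis
  proof (cases "b \<in># M")
    case True
    then show ?thesis
      using weights_from_leaf_removals_least[OF M M' twos eq] b min by blast
  next
    case False
    then have "M' = M"
      using b min by (intro weights_from_leaf_removals_least[OF M' M twos[symmetric] eq[symmetric], of b]) auto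
    then show ?thesis ..
  qed
next
  case False
  have "x = 2" if "x \<in># M + M'" for x
  proof -
    have "x < 3" using False that by (meson not_le)
    moreover have "x \<ge> 2" using M M' that by auto
    ultimately show ?thesis by simp
  qed
  then have "set_mset M \<subseteq> {2}" "set_mset M' \<subseteq> {2}" by auto
  then have "M = replicate_mset (size M) 2" "M' = replicate_mset (size M') 2"
    by (auto dest: set_mset_subset_singletonD)
  then show ?thesis using size by simp
qed

text \<open>
  The analogue of \<open>leaf_removals\<close> after the ends of an edge with weight pair \<open>p\<close> have been
  merged. The merged vertex carries the leaves of both ends, which are \<open>2\<close> fewer than its
  weight \<open>sum_mset p\<close>.
\<close>

definition contraction_removals :: "nat multiset \<Rightarrow> nat multiset \<Rightarrow> nat multiset multiset" where
  "contraction_removals M p = replicate_mset (sum_mset p - 2) (add_mset (sum_mset p - 1) (M - p))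
    + (\<Sum>x\<in>#M - p. replicate_mset (x - 1) (add_mset (x - 1) (add_mset (sum_mset p) (M - p - {#x#}))))"

lemma mem_contraction_removals:
  "N \<in># contraction_removals M p \<longleftrightarrow>
    sum_mset p > 2 \<and> N = add_mset (sum_mset p - 1) (M - p) \<or>
    (\<exists>x\<in>#M - p. x > 1 \<and> N = add_mset (x - 1) (add_mset (sum_mset p) (M - p - {#x#})))"
  unfolding contraction_removals_def union_iff mem_sum_mset set_image_mset bex_simps in_replicate_mset
  by simp

lemma size_2_msetE:
  assumes "size p = 2" obtains a b where "p = {#a, b#}"
proof -
  obtain a q where "p = add_mset a q" "size q = 1"
    using assms size_eq_Suc_imp_eq_union[of p 1] by auto
  then show ?thesis using that size_1_singleton_mset[of q] by auto
qed

text \<open>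
  Compare the multiset obtained from \<open>p\<close> by lowering the merged part with one obtained from
  \<open>q\<close>. After adding \<open>p\<close> and \<open>q\<close> back, \<open>M\<close> cancels and a multiset identity between
  few elements remains. As all weights are at least \<open>2\<close>, neither the sum of \<open>p\<close> nor its
  predecessor is an element of \<open>p\<close>, and this leaves only \<open>q = p\<close> and the case in which the
  sum of \<open>q\<close> is one less.
\<close>

lemma contraction_removals_triangular:
  assumes M: "\<And>x. x \<in># M \<Longrightarrow> x \<ge> 2"
    and p: "size p = 2" "p \<subseteq># M" and q: "q \<subseteq># M"
    and mem: "add_mset (sum_mset p - 1) (M - p) \<in># contraction_removals M q"
  shows "q = p \<or> sum_mset q < sum_mset p"
proof -
  obtain a b where ab: "p = {#a, b#}" using p(1) by (rule size_2_msetE)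
  have "a \<in># M" "b \<in># M" using p(2) unfolding ab by (auto dest: mset_subset_eqD)
  then have ab2: "a \<ge> 2" "b \<ge> 2" using M by auto
  have sp: "sum_mset p - 1 \<notin># p" "sum_mset p \<notin># p" "sum_mset p > 0" using ab2 by (auto simp: ab)
  from mem consider "add_mset (sum_mset p - 1) (M - p) = add_mset (sum_mset q - 1) (M - q)" "sum_mset q > 2"
    | x where "x \<in># M - q" "x > 1"
      "add_mset (sum_mset p - 1) (M - p) = add_mset (x - 1) (add_mset (sum_mset q) (M - q - {#x#}))"
    unfolding mem_contraction_removals by blast
  then show ?thesis
  proof cases
    case 1
    \<comment> \<open>The part lowered in the second multiset is the merged one.\<close>
    then have "add_mset (sum_mset p - 1) (M - p) + p + q = add_mset (sum_mset q - 1) (M - q) + q + p" by simp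
    then have *: "add_mset (sum_mset p - 1) q = add_mset (sum_mset q - 1) p"
      using p(2) q by (simp add: ac_simps)
    have "sum_mset p - 1 = sum_mset q - 1"
      using arg_cong[OF *, of "\<lambda>W. sum_mset p - 1 \<in># W"] sp by auto
    then show ?thesis using * by simp
  next
    case 2
    \<comment> \<open>The part lowered in the second multiset is an unmerged weight \<open>x\<close>.\<close>
    have "add_mset (sum_mset p - 1) (M - p) + p + (q + {#x#})
        = add_mset (x - 1) (add_mset (sum_mset q) (M - q - {#x#} + {#x#})) + q + p"
      unfolding 2 by simp
    also have "M - q - {#x#} + {#x#} = M - q" by (rule insert_DiffM2) (rule 2)
    finally have "add_mset (sum_mset p - 1) M + (q + {#x#}) = add_mset (x - 1) (add_mset (sum_mset q) M) + p"
      using p(2) q by (simp add: ac_simps)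
    then have *: "add_mset (sum_mset p - 1) (add_mset x q) = add_mset (x - 1) (add_mset (sum_mset q) p)"
      by (simp add: ac_simps)
    consider "sum_mset p - 1 = x - 1" | "sum_mset p - 1 = sum_mset q"
      using arg_cong[OF *, of "\<lambda>W. sum_mset p - 1 \<in># W"] sp by auto
    then show ?thesis
    proof cases
      case 1
      then have x: "x = sum_mset p" using 2 sp by simp
      then have **: "add_mset x q = add_mset (sum_mset q) p" using * 1 by simp
      then have "x \<in># add_mset (sum_mset q) p" by (metis union_single_eq_member)
      then have "x = sum_mset q" using sp x by auto
      then show ?thesis using ** by simp
    next
      case 2
      then show ?thesis using sp by linarith
    qed
  qed
qed

text \<open>
  The system is triangular with respect to the sum of the pair. The testing multisets do not
  contain \<open>1\<close>, because the lowered part is at least \<open>3\<close>; hence they survive the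
  filter.
\<close>

lemma pairs_from_contraction_removals:
  assumes M: "\<And>x. x \<in># M \<Longrightarrow> x \<ge> 2"
    and XY: "\<And>p. p \<in># X + Y \<Longrightarrow> size p = 2 \<and> p \<subseteq># M"
    and eq: "filter_mset (\<lambda>N. 1 \<notin># N) (\<Sum>p\<in>#X. contraction_removals M p)
      = filter_mset (\<lambda>N. 1 \<notin># N) (\<Sum>p\<in>#Y. contraction_removals M p)"
  shows "X = Y"
proof (rule multiset_eq_triangular[where s = sum_mset])
  let ?N = "\<lambda>p. add_mset (sum_mset p - 1) (M - p)"
  let ?G = "\<lambda>p q. count (contraction_removals M q) (?N p)"
  have big: "sum_mset p > 2" if "p \<in># X + Y" for p
  proof -
    have p: "size p = 2" "p \<subseteq># M" using XY[OF that] by auto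
    have "2 * size p \<le> sum_mset p"
      using p(2) by (induction p) (auto dest!: M mset_subset_eq_insertD subset_mset.less_imp_le)
    then show ?thesis using p by simp
  qed
  show "q = p \<or> sum_mset q < sum_mset p"
    if "p \<in># X + Y" "q \<in># X + Y" "?G p q \<noteq> 0" for p q
    using that XY by (intro contraction_removals_triangular[OF M]) auto
  show "?G p p \<noteq> 0" if "p \<in># X + Y" for p
    using big[OF that] by (simp add: mem_contraction_removals flip: not_in_iff)
  show "(\<Sum>q\<in>#X. ?G p q) = (\<Sum>q\<in>#Y. ?G p q)" if "p \<in># X + Y" for p
  proof -
    have "1 \<notin># ?N p" using big[OF that] M by (auto dest!: in_diffD) force
    then show ?thesis
      using arg_cong[OF eq, of "\<lambda>W. count W (?N p)"] by (simp add: count_sum_mset)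
  qed
qed

section \<open>Proper trees\<close>

lemma reachable_imp_rtrancl:
  "reachable H u v \<Longrightarrow> (u, v) \<in> (arcs_ends H)\<^sup>*"
  unfolding reachable_def by (induction rule: rtrancl_on_induct) auto

lemma arcs_of_edges_of: "pair_graph G \<Longrightarrow> arcs_of (edges_of G) = parcs G"
  by (auto simp: arcs_of_def edge_iff_arc)

lemma undirected_tree_connected:
  assumes "undirected_tree G" "u \<in> pverts G" "v \<in> pverts G"
  shows "(u, v) \<in> linked (edges_of G)"
proof -
  have G: "pair_graph G" and "Digraph_Component.connected (with_proj G)"
    using assms by (auto simp: undirected_tree_def)
  then have "reachable (with_proj (mk_symmetric (with_proj G))) u v"
    using assms(2,3) by (auto simp: Digraph_Component.connected_def strongly_connected_def mk_symmetric_def)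
  then have "(u, v) \<in> (parcs (mk_symmetric (with_proj G)))\<^sup>*"
    using reachable_imp_rtrancl by fastforce
  also have "parcs (mk_symmetric (with_proj G)) = parcs G"
    using pair_graph_sym[OF G] by (auto simp: mk_symmetric_def)
  finally show ?thesis by (simp add: linked_def arcs_of_edges_of[OF G])
qed

text \<open>
  If the ends of an edge were linked without it, a simple path between them would have
  length at least two, and the edge would close it to a cycle of length at least three.
\<close>

lemma undirected_tree_bridge:
  assumes tree: "undirected_tree G" and uv: "{u, v} \<in> edges_of G"
  shows "(u, v) \<notin> linked (edges_of G - {{u, v}})"
proof
  assume linked: "(u, v) \<in> linked (edges_of G - {{u, v}})"
  have G: "pair_graph G" and acyclic: "\<And>p. pre_digraph.cycle (with_proj G) p \<Longrightarrow> length p < 3"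
    using tree by (auto simp: undirected_tree_def not_le)
  interpret G: pair_graph G by fact
  interpret S: simple_graph "pverts G" "edges_of G" by (rule pair_graph_simple_graph[OF G])
  define H where "H = \<lparr>pverts = pverts G, parcs = arcs_of (edges_of G - {{u, v}})\<rparr>"
  have sub: "parcs H \<subseteq> parcs G - {(u, v), (v, u)}"
    by (auto simp: H_def arcs_of_def edge_iff_arc[OF G] insert_commute)
  interpret H: pair_wf_digraph H
    by unfold_locales (use sub G.wellformed' in \<open>force simp: H_def\<close>)+
  have "u \<in> pverts H" using S.edge_in_V[OF uv] by (simp add: H_def)
  have "(u, v) \<in> (parcs H)\<^sup>*" using linked by (simp add: linked_def H_def)
  then have "reachable (with_proj H) u v"
  proof (induction rule: rtrancl_induct)
    case base
    then show ?case using \<open>u \<in> pverts H\<close> by simp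
  next
    case (step y z)
    then show ?case by (meson H.reachable_adjI H.reachable_trans)
  qed
  then obtain p where "H.apath u p v" by (auto simp: H.reachable_apath)
  then have p: "H.awalk u p v" "distinct (pawalk_verts u p)" by (auto simp: H.apath_def)
  have aw: "G.awalk v ((v, u) # p) v"
    using p(1)[unfolded H.awalk_def] sub S.edge_in_V[OF uv] uv
    by (auto simp: G.awalk_def edge_iff_arc[OF G] pair_graph_sym[OF G, of v u])
  then have "G.cycle ((v, u) # p)"
    using p(2) unfolding G.cycle_def by (intro exI[of _ v]) auto
  then have "length p < 2" using acyclic by fastforce
  then consider "p = []" | e where "p = [e]" by (cases p; cases "tl p") auto
  then show False
  proof cases
    case 1
    then show False using p(1) S.edge_neq[OF uv] by (simp add: H.awalk_def)
  next
    case 2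
    then show False using p(1) sub by (auto simp: H.awalk_def)
  qed
qed

lemma out_degree_with_proj: "out_degree (with_proj H) v = card {u. (v, u) \<in> parcs H}"
proof -
  have "out_arcs (with_proj H) v = Pair v ` {u. (v, u) \<in> parcs H}"
    by (auto simp: out_arcs_def)
  then show ?thesis by (simp add: out_degree_def card_image inj_on_def)
qed

locale proper_tree_graph =
  fixes T :: "'a pair_pre_digraph"
  assumes proper: "proper_tree T"
begin

abbreviation "V \<equiv> pverts T"
abbreviation "E \<equiv> edges_of T"
abbreviation "L \<equiv> leaves T"
abbreviation "C \<equiv> V - L"

lemma tree: "undirected_tree T" and card_V: "card V \<ge> 3"
  using proper by (auto simp: proper_tree_def)

lemma pair_graph_T: "pair_graph T" using tree by (simp add: undirected_tree_def)

sublocale forest_graph V E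
proof -
  interpret simple_graph V E by (rule pair_graph_simple_graph[OF pair_graph_T])
  show "forest_graph V E" by unfold_locales (rule undirected_tree_bridge[OF tree])
qed

lemma arc_iff_edge: "(u, v) \<in> parcs T \<longleftrightarrow> {u, v} \<in> E"
  using edge_iff_arc[OF pair_graph_T] by simp

lemma connected: "u \<in> V \<Longrightarrow> v \<in> V \<Longrightarrow> (u, v) \<in> linked E"
  using undirected_tree_connected[OF tree] .

lemma leaves_subset: "L \<subseteq> V" by (auto simp: leaves_def)

lemma finite_L [simp]: "finite L" using leaves_subset finite_V by (rule finite_subset)

lemma leaf_unique_neighbour:
  assumes "l \<in> L" shows "\<exists>!c. {l, c} \<in> E"
proof -
  have "card {c. {l, c} \<in> E} = 1"
    using assms by (simp add: leaves_def out_degree_with_proj edge_iff_arc[OF pair_graph_T])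
  then obtain x where "{c. {l, c} \<in> E} = {x}" by (auto simp: card_1_singleton_iff)
  then show ?thesis by (metis mem_Collect_eq singleton_iff)
qed

definition par :: "'a \<Rightarrow> 'a" where "par l = (THE c. {l, c} \<in> E)"

lemma edge_of_leaf_iff: "l \<in> L \<Longrightarrow> {l, x} \<in> E \<longleftrightarrow> x = par l"
  unfolding par_def using leaf_unique_neighbour[of l] by (metis (no_types, lifting) theI')

lemma par_edge: "l \<in> L \<Longrightarrow> {l, par l} \<in> E"
  using edge_of_leaf_iff by simp

text \<open>
  Two adjacent leaves would form a component of their own, but the tree has at least three
  vertices.
\<close>

lemma par_in_C:
  assumes l: "l \<in> L" shows "par l \<in> C"
proof -
  have "par l \<in> V" using par_edge[OF l] edge_in_V by blast
  moreover have "par l \<notin> L"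
  proof
    assume m: "par l \<in> L"
    have "{par l, l} \<in> E" using par_edge[OF l] by (simp add: insert_commute)
    then have pp: "par (par l) = l" using edge_of_leaf_iff[OF m] by simp
    have "V \<subseteq> {l, par l}"
    proof
      fix x assume "x \<in> V"
      then have "(l, x) \<in> linked E" using connected l leaves_subset by blast
      then have "(l \<in> {l, par l}) = (x \<in> {l, par l})"
      proof (rule linked_invariant)
        fix u v assume uv: "{u, v} \<in> E"
        then have vu: "{v, u} \<in> E" by (simp add: insert_commute)
        show "(u \<in> {l, par l}) = (v \<in> {l, par l})"
          using edge_of_leaf_iff[OF l] edge_of_leaf_iff[OF m] pp uv vu by auto
      qed
      then show "x \<in> {l, par l}" by simp
    qed
    then have "card V \<le> card {l, par l}" by (intro card_mono) auto
    also have "\<dots> \<le> 2" by (simp add: card_insert_if)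
    finally show False using card_V by simp
  qed
  ultimately show ?thesis by simp
qed

definition leaf_edges :: "'a set \<Rightarrow> 'a set set" where
  "leaf_edges B = (\<lambda>l. {l, par l}) ` B"

definition inner_edges :: "'a set set" where
  "inner_edges = {e \<in> E. e \<subseteq> C}"

lemma leaf_edge_inj: "l \<in> L \<Longrightarrow> l' \<in> L \<Longrightarrow> {l, par l} = {l', par l'} \<longleftrightarrow> l = l'"
  using par_in_C by (auto simp: doubleton_eq_iff)

lemma inj_leaf_edge: "inj_on (\<lambda>l. {l, par l}) L"
  by (auto simp: inj_on_def leaf_edge_inj)

lemma card_leaf_edges: "B \<subseteq> L \<Longrightarrow> card (leaf_edges B) = card B"
  unfolding leaf_edges_def using inj_leaf_edge by (intro card_image) (rule inj_on_subset)

lemma leaf_edges_subset: "B \<subseteq> L \<Longrightarrow> leaf_edges B \<subseteq> E"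
  using par_edge by (auto simp: leaf_edges_def)

lemma leaf_inner_disjoint: "B \<subseteq> L \<Longrightarrow> leaf_edges B \<inter> inner_edges = {}"
  by (auto simp: leaf_edges_def inner_edges_def)

lemma edge_cases: "E = leaf_edges L \<union> inner_edges"
proof
  show "E \<subseteq> leaf_edges L \<union> inner_edges"
  proof
    fix e assume e: "e \<in> E"
    then obtain u v where uv: "u \<in> V" "v \<in> V" "e = {u, v}" using edgeE by blast
    then have "{v, u} \<in> E" "{u, v} \<in> E" using e by (auto simp: insert_commute)
    then have "u \<in> L \<Longrightarrow> v = par u" "v \<in> L \<Longrightarrow> u = par v"
      using edge_of_leaf_iff by blast+
    then have "u \<in> L \<Longrightarrow> e = {u, par u}" "v \<in> L \<Longrightarrow> e = {v, par v}"
      using uv by (simp_all add: insert_commute)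
    then show "e \<in> leaf_edges L \<union> inner_edges"
      using uv e by (auto simp: leaf_edges_def inner_edges_def)
  qed
  show "leaf_edges L \<union> inner_edges \<subseteq> E"
    using leaf_edges_subset by (auto simp: inner_edges_def)
qed

lemma finite_inner_edges [simp]: "finite inner_edges"
  using finite_E by (simp add: inner_edges_def)

abbreviation "w \<equiv> skeleton_weight T"

lemma weight_eq: "w c = 1 + card {l \<in> L. par l = c}"
proof -
  have "{l \<in> L. (c, l) \<in> parcs T} = {l \<in> L. par l = c}"
    using edge_of_leaf_iff[of _ c] by (auto simp: arc_iff_edge insert_commute[of c])
  then show ?thesis by (simp add: skeleton_weight_def)
qed

lemma hanging_leaf:
  assumes "c \<in> C" obtains l where "l \<in> L" "par l = c"
proof -
  obtain l where "l \<in> L" "(c, l) \<in> parcs T" using proper assms by (auto simp: proper_tree_def)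
  then show ?thesis
    using that edge_of_leaf_iff[of l c] by (simp add: arc_iff_edge insert_commute)
qed

lemma weight_ge_2: "c \<in> C \<Longrightarrow> w c \<ge> 2"
  by (rule hanging_leaf[of c]) (auto simp: weight_eq Suc_le_eq card_gt_0_iff)

text \<open>
  A non-leaf of weight \<open>w c\<close> carries \<open>w c - 1\<close> leaves.
\<close>

lemma sum_over_leaves:
  fixes g :: "'a \<Rightarrow> 'b multiset"
  shows "image_mset (\<lambda>l. h (par l)) (mset_set L) = (\<Sum>c\<in>C. replicate_mset (w c - 1) (h c))"
proof (rule multiset_eqI)
  fix y
  have "card {l \<in> L. h (par l) = y} = (\<Sum>c\<in>C. card {l \<in> {l \<in> L. h (par l) = y}. par l = c})"
    unfolding card_eq_sum using par_in_C finite_V by (intro sum.group[symmetric]) auto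
  also have "\<dots> = (\<Sum>c\<in>C. count (replicate_mset (w c - 1) (h c)) y)"
    by (intro sum.cong refl) (auto simp: weight_eq intro!: arg_cong[of _ _ card])
  finally show "count (image_mset (\<lambda>l. h (par l)) (mset_set L)) y
      = count (\<Sum>c\<in>C. replicate_mset (w c - 1) (h c)) y"
    by (simp add: count_image_mset_set count_sum)
qed

end

section \<open>Component sizes of edge sets isolating one leaf\<close>

context proper_tree_graph
begin

text \<open>
  The centre of the star in which \<open>x\<close> lies when only the leaves in \<open>B\<close> are attached.
\<close>

definition hub :: "'a set \<Rightarrow> 'a \<Rightarrow> 'a" where
  "hub B x = (if x \<in> B then par x else x)"

lemma linked_leaf_edges:
  assumes "B \<subseteq> L"
  shows "(x, y) \<in> linked (leaf_edges B) \<longleftrightarrow> hub B x = hub B y"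
proof
  assume "(x, y) \<in> linked (leaf_edges B)"
  then show "hub B x = hub B y"
  proof (rule linked_invariant)
    fix u v assume "{u, v} \<in> leaf_edges B"
    then obtain l where "l \<in> B" "{u, v} = {l, par l}" by (auto simp: leaf_edges_def)
    moreover have "par l \<notin> B" using par_in_C[of l] \<open>l \<in> B\<close> assms by blast
    ultimately show "hub B u = hub B v" by (auto simp: hub_def doubleton_eq_iff)
  qed
next
  have h: "(x, hub B x) \<in> linked (leaf_edges B)" for x
    by (auto simp: hub_def leaf_edges_def intro!: linked_edge)
  assume "hub B x = hub B y"
  then show "(x, y) \<in> linked (leaf_edges B)"
    using h[of x] h[of y] by (metis linked_sym linked_trans)
qed

text \<open>
  The skeleton weights after the leaf \<open>l\<close> has been detached.
\<close>

definition reduced_weight :: "'a \<Rightarrow> 'a \<Rightarrow> nat" where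
  "reduced_weight l c = (if c = par l then w c - 1 else w c)"

lemma card_component_leaf_edges:
  assumes l: "l \<in> L" and c: "c \<in> C"
  shows "card (component (leaf_edges (L - {l})) c) = reduced_weight l c"
proof -
  have "component (leaf_edges (L - {l})) c = insert c {x \<in> L - {l}. par x = c}"
    using c par_in_C by (auto simp: linked_leaf_edges hub_def split: if_splits)
  moreover have "c \<notin> {x \<in> L - {l}. par x = c}" using c by auto
  ultimately have "card (component (leaf_edges (L - {l})) c) = Suc (card {x \<in> L - {l}. par x = c})"
    by simp
  also have "{x \<in> L - {l}. par x = c} = {x \<in> L. par x = c} - {l}" by auto
  also have "Suc (card \<dots>) = reduced_weight l c"
    using l by (auto simp: reduced_weight_def weight_eq card_Diff_singleton_if
      intro!: Suc_pred simp: card_gt_0_iff)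
  finally show ?thesis .
qed

lemma comp_sizes_leaf_edges:
  assumes l: "l \<in> L"
  shows "comp_sizes V (leaf_edges (L - {l})) = add_mset 1 (image_mset (reduced_weight l) (mset_set C))"
proof -
  let ?S = "leaf_edges (L - {l})" and ?D = "insert l C"
  have D: "hub (L - {l}) x = x" if "x \<in> ?D" for x using that by (auto simp: hub_def)
  have "components V ?S = component ?S ` ?D"
  proof
    show "component ?S ` ?D \<subseteq> components V ?S"
      using l leaves_subset by (auto simp: components_def)
    show "components V ?S \<subseteq> component ?S ` ?D"
    proof
      fix Z assume "Z \<in> components V ?S"
      then obtain x where x: "x \<in> V" "Z = component ?S x" by (auto simp: components_def)
      have h: "hub (L - {l}) x \<in> ?D" using x par_in_C by (auto simp: hub_def)
      then have "Z = component ?S (hub (L - {l}) x)"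
        unfolding x component_eq_iff using D by (simp add: linked_leaf_edges)
      then show "Z \<in> component ?S ` ?D" using h by blast
    qed
  qed
  moreover have inj: "inj_on (component ?S) ?D"
    unfolding inj_on_def component_eq_iff using D by (simp add: linked_leaf_edges)
  ultimately have "comp_sizes V ?S = image_mset (\<lambda>x. card (component ?S x)) (mset_set ?D)"
    by (simp only: comp_sizes_def image_mset_mset_set[OF inj, symmetric] image_mset.compositionality comp_def)
  moreover have "component ?S l = {l}"
  proof -
    have "x = l" if "hub (L - {l}) x = l" for x
      using that par_in_C[of x] l by (auto simp: hub_def split: if_splits)
    moreover have "hub (L - {l}) l = l" using D by simp
    moreover have "component ?S l = {x. hub (L - {l}) l = hub (L - {l}) x}"
      unfolding set_eq_iff mem_component mem_Collect_eq by (subst linked_leaf_edges) auto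
    ultimately show ?thesis by auto
  qed
  moreover have "l \<notin> C" using l by simp
  moreover have "image_mset (\<lambda>x. card (component ?S x)) (mset_set C) = image_mset (reduced_weight l) (mset_set C)"
    using l by (intro image_mset_cong) (simp add: card_component_leaf_edges)
  ultimately show ?thesis using finite_V by simp
qed

definition weights :: "nat multiset" where
  "weights = image_mset w (mset_set C)"

definition edge_weights :: "'a set \<Rightarrow> nat multiset" where
  "edge_weights e = image_mset w (mset_set e)"

lemma inner_edgeE:
  assumes "e \<in> inner_edges"
  obtains u v where "u \<in> C" "v \<in> C" "u \<noteq> v" "e = {u, v}"
  using assms edgeE[of e] by (auto simp: inner_edges_def)

lemma edge_weights_subset: "e \<in> inner_edges \<Longrightarrow> edge_weights e \<subseteq># weights"
  unfolding edge_weights_def weights_def using finite_V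
  by (intro image_mset_subseteq_mono subset_imp_msubset_mset_set) (auto simp: inner_edges_def)

lemma image_reduced_weight:
  assumes l: "l \<in> L" and D: "D \<subseteq> C" and A: "A = image_mset w (mset_set D)"
  shows "image_mset (reduced_weight l) (mset_set D)
    = (if par l \<in> D then add_mset (w (par l) - 1) (A - {#w (par l)#}) else A)"
proof -
  have fin: "finite D" using D finite_V by (meson finite_Diff finite_subset)
  show ?thesis
  proof (cases "par l \<in> D")
    case True
    have "mset_set D = add_mset (par l) (mset_set (D - {par l}))"
      using fin True by (simp add: mset_set.remove)
    moreover have "image_mset (reduced_weight l) (mset_set (D - {par l})) = image_mset w (mset_set (D - {par l}))"
      using fin by (intro image_mset_cong) (auto simp: reduced_weight_def)
    ultimately show ?thesis using True by (simp add: A reduced_weight_def)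
  next
    case False
    then show ?thesis using fin unfolding A by (auto simp: reduced_weight_def intro!: image_mset_cong)
  qed
qed

lemma comp_sizes_leaf_edges_weights:
  assumes l: "l \<in> L"
  shows "comp_sizes V (leaf_edges (L - {l}))
    = add_mset 1 (add_mset (w (par l) - 1) (weights - {#w (par l)#}))"
  using image_reduced_weight[OF l order_refl weights_def] par_in_C[OF l]
  by (simp add: comp_sizes_leaf_edges[OF l])

text \<open>
  The component sizes other than that of the isolated leaf, when a leaf at \<open>c\<close> is detached and
  the skeleton edge \<open>e\<close> is added to the leaf edges. Either the merged part is lowered or the weight of
  \<open>c\<close>, according to whether \<open>c\<close> is an end of \<open>e\<close>.
\<close>

definition contracted_sizes :: "'a \<Rightarrow> 'a set \<Rightarrow> nat multiset" where
  "contracted_sizes c e = (let p = edge_weights e in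
     if c \<in> e then add_mset (sum_mset p - 1) (weights - p)
     else add_mset (w c - 1) (add_mset (sum_mset p) (weights - p - {#w c#})))"

lemma weights_minus_edge:
  assumes "e \<in> inner_edges"
  shows "weights - edge_weights e = image_mset w (mset_set (C - e))"
proof -
  have "mset_set C = mset_set e + mset_set (C - e)"
    using assms finite_V by (subst mset_set_Union[symmetric])
      (auto simp: inner_edges_def Un_absorb1 intro: finite_subset)
  then show ?thesis by (simp add: weights_def edge_weights_def)
qed

lemma comp_sizes_contracted:
  assumes l: "l \<in> L" and e: "e \<in> inner_edges"
  shows "comp_sizes V (insert e (leaf_edges (L - {l}))) = add_mset 1 (contracted_sizes (par l) e)"
proof -
  let ?S = "leaf_edges (L - {l})" and ?r = "reduced_weight l" and ?p = "edge_weights e"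
  obtain u v where uv: "u \<in> C" "v \<in> C" "u \<noteq> v" "e = {u, v}" using e by (rule inner_edgeE)
  have "(u, v) \<notin> linked ?S" using uv by (simp add: linked_leaf_edges hub_def)
  then have "comp_sizes V (insert {u, v} ?S) + {#?r u, ?r v#} = add_mset (?r u + ?r v) (comp_sizes V ?S)"
    using comp_sizes_insert[of ?S u v] leaf_edges_subset[of "L - {l}"] uv l
    by (simp add: card_component_leaf_edges)
  moreover have "mset_set C = mset_set {u, v} + mset_set (C - {u, v})"
    using uv finite_V by (subst mset_set_Union[symmetric]) (auto simp: insert_absorb)
  ultimately have 1: "comp_sizes V (insert e ?S)
      = add_mset 1 (add_mset (?r u + ?r v) (image_mset ?r (mset_set (C - e))))"
    using uv by (simp add: comp_sizes_leaf_edges[OF l])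
  have sum_p: "sum_mset ?p = w u + w v" using uv by (simp add: edge_weights_def)
  have rest: "image_mset ?r (mset_set (C - e)) = (if par l \<in> C - e then add_mset (w (par l) - 1)
      (weights - ?p - {#w (par l)#}) else weights - ?p)"
    using l by (intro image_reduced_weight weights_minus_edge[OF e]) auto
  show ?thesis
  proof (cases "par l \<in> e")
    case True
    then have "?r u + ?r v = w u + w v - 1"
      using weight_ge_2[OF uv(1)] weight_ge_2[OF uv(2)] uv by (auto simp: reduced_weight_def)
    then show ?thesis using True by (simp add: 1 rest contracted_sizes_def sum_p)
  next
    case False
    then have "?r u + ?r v = w u + w v" using uv by (auto simp: reduced_weight_def)
    then show ?thesis using False par_in_C[OF l]
      by (simp add: 1 rest contracted_sizes_def sum_p add_mset_commute)
  qed
qed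

lemma sum_image_mset_set: "(\<Sum>x\<in>A. f (h x)) = (\<Sum>y\<in>#image_mset h (mset_set A). f y)"
  by (simp add: sum_unfold_sum_mset image_mset.compositionality comp_def)

lemma leaf_removals_weights:
  "image_mset (\<lambda>l. add_mset (w (par l) - 1) (weights - {#w (par l)#})) (mset_set L)
    = leaf_removals weights"
  unfolding sum_over_leaves[of "\<lambda>c. add_mset (w c - 1) (weights - {#w c#})"] leaf_removals_def
  by (subst (3) weights_def) (rule sum_image_mset_set)

lemma contraction_removals_weights:
  assumes e: "e \<in> inner_edges"
  shows "image_mset (\<lambda>l. contracted_sizes (par l) e) (mset_set L)
    = contraction_removals weights (edge_weights e)"
proof -
  let ?p = "edge_weights e"
  obtain u v where uv: "u \<in> C" "v \<in> C" "u \<noteq> v" "e = {u, v}" using e by (rule inner_edgeE)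
  have "(\<Sum>c\<in>C. replicate_mset (w c - 1) (contracted_sizes c e))
    = (\<Sum>c\<in>C - e. replicate_mset (w c - 1) (contracted_sizes c e))
      + (\<Sum>c\<in>e. replicate_mset (w c - 1) (contracted_sizes c e))"
    using e finite_V by (intro sum.subset_diff) (auto simp: inner_edges_def)
  also have "(\<Sum>c\<in>e. replicate_mset (w c - 1) (contracted_sizes c e))
    = replicate_mset (sum_mset ?p - 2) (add_mset (sum_mset ?p - 1) (weights - ?p))"
    using uv weight_ge_2[OF uv(1)] weight_ge_2[OF uv(2)]
    by (intro multiset_eqI) (auto simp: contracted_sizes_def edge_weights_def)
  also have "(\<Sum>c\<in>C - e. replicate_mset (w c - 1) (contracted_sizes c e))
    = (\<Sum>c\<in>C - e. replicate_mset (w c - 1)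
        (add_mset (w c - 1) (add_mset (sum_mset ?p) (weights - ?p - {#w c#}))))"
    by (intro sum.cong) (auto simp: contracted_sizes_def Let_def)
  also have "\<dots> = (\<Sum>x\<in>#weights - ?p. replicate_mset (x - 1)
        (add_mset (x - 1) (add_mset (sum_mset ?p) (weights - ?p - {#x#}))))"
    unfolding weights_minus_edge[OF e] by (rule sum_image_mset_set)
  finally show ?thesis
    unfolding sum_over_leaves[of "\<lambda>c. contracted_sizes c e"] contraction_removals_def by (simp add: add.commute)
qed

lemma singleton_component:
  assumes "x \<in> V" "\<And>y. {x, y} \<notin> S"
  shows "{x} \<in> components V S"
proof -
  have "y = x" if "(x, y) \<in> linked S" for y
    using that assms(2) unfolding linked_def
    by (cases rule: converse_rtranclE) (auto simp: arcs_of_def)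
  then have "component S x = {x}" by auto
  then show ?thesis using component_in[OF assms(1), of S] by simp
qed

text \<open>
  A leaf whose edge is missing is isolated, so at most one leaf edge is missing. If none is
  missing, no vertex is isolated, because every non-leaf carries a leaf.
\<close>

lemma unique_missing_leaf:
  assumes S: "S \<subseteq> E" and N: "comp_sizes V S = add_mset 1 N" "1 \<notin># N"
  obtains l where "l \<in> L" "S = leaf_edges (L - {l}) \<union> (S \<inter> inner_edges)"
proof -
  have iso: "\<exists>Z. {Z \<in> components V S. card Z = 1} = {Z}"
  proof -
    have "card {Z \<in> components V S. card Z = 1} = 1"
      using count_comp_sizes[of S 1, symmetric] N by (simp add: not_in_iff)
    then show ?thesis by (rule card_1_singletonE) blast
  qed
  have leaf: "{l} \<in> components V S" if "l \<in> L" "{l, par l} \<notin> S" for l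
    using that leaves_subset S edge_of_leaf_iff[OF that(1)]
    by (intro singleton_component) (auto dest: subsetD)
  have "\<exists>l\<in>L. {l, par l} \<notin> S"
  proof (rule ccontr)
    assume "\<not> (\<exists>l\<in>L. {l, par l} \<notin> S)"
    then have all: "{l, par l} \<in> S" if "l \<in> L" for l using that by blast
    obtain Z where Z: "Z \<in> components V S" "card Z = 1" using iso by blast
    then obtain x where x: "x \<in> V" "Z = component S x" by (auto simp: components_def)
    obtain y where "x \<noteq> y" "{x, y} \<in> S"
    proof (cases "x \<in> L")
      case True
      then have "x \<noteq> par x" using par_in_C[of x] by auto
      then show ?thesis using that[of "par x"] all[OF True] by blast
    next
      case False
      then obtain l where "l \<in> L" "par l = x" using x hanging_leaf by blast
      moreover from this have "x \<noteq> l" "{x, l} \<in> S" using False all[of l] by (auto simp: insert_commute)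
      ultimately show ?thesis using that by blast
    qed
    then have "{x, y} \<subseteq> Z" using x by (auto intro: linked_edge)
    moreover have "finite Z" using Z by (simp add: card_ge_0_finite)
    ultimately have "card {x, y} \<le> card Z" by (intro card_mono)
    then show False using \<open>x \<noteq> y\<close> Z by simp
  qed
  then obtain l where l: "l \<in> L" "{l, par l} \<notin> S" by blast
  have "{l', par l'} \<in> S" if "l' \<in> L" "l' \<noteq> l" for l'
  proof (rule ccontr)
    assume "{l', par l'} \<notin> S"
    then have "{l'} \<in> {Z \<in> components V S. card Z = 1}" "{l} \<in> {Z \<in> components V S. card Z = 1}"
      using leaf l that by auto
    then have "{l'} = {l}" using iso by (metis singletonD)
    then show False using that by simp
  qed
  then have "S \<inter> leaf_edges L = leaf_edges (L - {l})"
    using l leaf_edge_inj by (auto simp: leaf_edges_def)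
  then have "S = leaf_edges (L - {l}) \<union> (S \<inter> inner_edges)"
    using S unfolding edge_cases by blast
  then show ?thesis using that l by blast
qed

end

section \<open>Weights and adjacent weight pairs are determined by the derivative\<close>

context proper_tree_graph
begin

lemma card_split: "card L + card C = card V"
  using leaves_subset finite_V by (simp add: card_Diff_subset card_mono)

lemma card_leaf_union:
  assumes "l \<in> L" "A \<subseteq> inner_edges"
  shows "card (leaf_edges (L - {l}) \<union> A) + 1 = card L + card A"
proof -
  have "card (leaf_edges (L - {l}) \<union> A) = card (leaf_edges (L - {l})) + card A"
    using leaf_inner_disjoint[of "L - {l}"] assms finite_inner_edges
    by (intro card_Un_disjoint) (auto simp: leaf_edges_def intro: finite_subset)
  also have "card (leaf_edges (L - {l})) = card L - 1" using assms by (simp add: card_leaf_edges)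
  moreover have "card L > 0" using assms by (auto simp: card_gt_0_iff)
  ultimately show ?thesis by simp
qed

text \<open>
  The number of parts reveals how many skeleton edges are used.
\<close>

lemma size_removed:
  assumes "S \<subseteq> E" "comp_sizes V S = add_mset 1 N" "l \<in> L" "S = leaf_edges (L - {l}) \<union> (S \<inter> inner_edges)"
  shows "size N + card (S \<inter> inner_edges) = card C"
  using forest_size_comp_sizes[OF assms(1)] card_leaf_union[OF assms(3), of "S \<inter> inner_edges"]
    card_split assms by simp

text \<open>
  Edge sets with one isolated leaf correspond to pairs of a leaf and a set of skeleton edges.
\<close>

lemma inj_leaf_removal:
  "inj_on (\<lambda>(l, A). leaf_edges (L - {l}) \<union> A) (L \<times> Pow inner_edges)"
proof (rule inj_onI, clarify)
  fix l A l' A' assume l: "l \<in> L" "l' \<in> L" and A: "A \<subseteq> inner_edges" "A' \<subseteq> inner_edges"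
    and e: "leaf_edges (L - {l}) \<union> A = leaf_edges (L - {l'}) \<union> A'"
  note d = leaf_inner_disjoint[of "L - {l}"] leaf_inner_disjoint[of "L - {l'}"] leaf_inner_disjoint[of L]
  have eq: "leaf_edges (L - {l}) = leaf_edges (L - {l'})" "A = A'" using d A e by blast+
  have "{l, par l} \<notin> leaf_edges (L - {l})" using l leaf_edge_inj by (auto simp: leaf_edges_def)
  then have "{l, par l} \<notin> leaf_edges (L - {l'})" using eq by simp
  then show "l = l' \<and> A = A'" using l eq by (auto simp: leaf_edges_def)
qed

abbreviation edge_sets :: "nat multiset \<Rightarrow> 'a set set set" where
  "edge_sets N \<equiv> {S. S \<subseteq> E \<and> comp_sizes V S = add_mset 1 N}"

lemma card_edge_sets_leaf_removals:
  assumes N: "1 \<notin># N" "size N = card C"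
  shows "card (edge_sets N) = count (leaf_removals weights) N"
proof -
  let ?f = "\<lambda>l. add_mset (w (par l) - 1) (weights - {#w (par l)#})"
  have "edge_sets N = (\<lambda>l. leaf_edges (L - {l})) ` {l \<in> L. ?f l = N}"
  proof
    show "edge_sets N \<subseteq> (\<lambda>l. leaf_edges (L - {l})) ` {l \<in> L. ?f l = N}"
    proof
      fix S assume "S \<in> edge_sets N"
      then have S: "S \<subseteq> E" "comp_sizes V S = add_mset 1 N" by auto
      obtain l where l: "l \<in> L" "S = leaf_edges (L - {l}) \<union> (S \<inter> inner_edges)"
        using unique_missing_leaf[OF S N(1)] .
      have "S \<inter> inner_edges = {}" using size_removed[OF S l] N(2) by simp
      then have "S = leaf_edges (L - {l})" using l by simp
      then show "S \<in> (\<lambda>l. leaf_edges (L - {l})) ` {l \<in> L. ?f l = N}"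
        using S l(1) comp_sizes_leaf_edges_weights[OF l(1)] by auto
    qed
    show "(\<lambda>l. leaf_edges (L - {l})) ` {l \<in> L. ?f l = N} \<subseteq> edge_sets N"
      using leaf_edges_subset by (auto simp: comp_sizes_leaf_edges_weights)
  qed
  moreover have "inj_on (\<lambda>l. leaf_edges (L - {l})) {l \<in> L. ?f l = N}"
  proof (rule inj_onI)
    fix l l' assume "l \<in> {l \<in> L. ?f l = N}" "l' \<in> {l \<in> L. ?f l = N}"
      "leaf_edges (L - {l}) = leaf_edges (L - {l'})"
    then show "l = l'" using inj_onD[OF inj_leaf_removal, of "(l, {})" "(l', {})"] by simp
  qed
  ultimately have "card (edge_sets N) = card {l \<in> L. ?f l = N}" by (simp add: card_image)
  also have "\<dots> = count (leaf_removals weights) N"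
    unfolding leaf_removals_weights[symmetric] by (simp add: count_image_mset_set)
  finally show ?thesis .
qed

definition weight_pairs :: "nat multiset multiset" where
  "weight_pairs = image_mset edge_weights (mset_set inner_edges)"

lemma card_edge_sets_contraction_removals:
  assumes N: "1 \<notin># N" "size N + 1 = card C"
  shows "card (edge_sets N) = count (\<Sum>p\<in>#weight_pairs. contraction_removals weights p) N"
proof -
  let ?P = "SIGMA e:inner_edges. {l \<in> L. contracted_sizes (par l) e = N}"
  let ?h = "\<lambda>(e, l). leaf_edges (L - {l}) \<union> {e}"
  have "edge_sets N = ?h ` ?P"
  proof
    show "edge_sets N \<subseteq> ?h ` ?P"
    proof
      fix S assume "S \<in> edge_sets N"
      then have S: "S \<subseteq> E" "comp_sizes V S = add_mset 1 N" by auto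
      obtain l where l: "l \<in> L" "S = leaf_edges (L - {l}) \<union> (S \<inter> inner_edges)"
        using unique_missing_leaf[OF S N(1)] .
      have "card (S \<inter> inner_edges) = 1" using size_removed[OF S l] N(2) by simp
      then obtain e where e: "S \<inter> inner_edges = {e}" by (rule card_1_singletonE)
      then have S': "S = leaf_edges (L - {l}) \<union> {e}" "e \<in> inner_edges" using l by auto
      then have "contracted_sizes (par l) e = N"
        using S(2) comp_sizes_contracted[OF l(1) S'(2)] by simp
      then show "S \<in> ?h ` ?P" using S' l(1) by force
    qed
    show "?h ` ?P \<subseteq> edge_sets N"
      using leaf_edges_subset by (auto simp: comp_sizes_contracted inner_edges_def dest: subsetD)
  qed
  moreover have "inj_on ?h ?P"
  proof (rule inj_onI, clarify)
    fix e l e' l' assume "e \<in> inner_edges" "e' \<in> inner_edges" "l \<in> L" "l' \<in> L"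
      "leaf_edges (L - {l}) \<union> {e} = leaf_edges (L - {l'}) \<union> {e'}"
    then show "e = e' \<and> l = l'"
      using inj_onD[OF inj_leaf_removal, of "(l, {e})" "(l', {e'})"] by auto
  qed
  ultimately have "card (edge_sets N) = card ?P" by (simp add: card_image)
  also have "\<dots> = (\<Sum>e\<in>inner_edges. card {l \<in> L. contracted_sizes (par l) e = N})"
    by (subst card_SigmaI) auto
  also have "\<dots> = (\<Sum>e\<in>inner_edges. count (contraction_removals weights (edge_weights e)) N)"
    by (intro sum.cong refl) (simp add: contraction_removals_weights[symmetric] count_image_mset_set)
  also have "\<dots> = count (\<Sum>p\<in>#weight_pairs. contraction_removals weights p) N"
    unfolding weight_pairs_def count_sum_mset by (rule sum_image_mset_set)
  finally show ?thesis .
qed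

lemma card_inner_edges: "card inner_edges + 1 = card C"
proof -
  obtain x where x: "x \<in> V" using card_V by fastforce
  have "component E ` V = (\<lambda>_. component E x) ` V"
    using connected[OF _ x] by (intro image_cong refl) (simp only: component_eq_iff)
  then have "components V E = {component E x}" using x by (auto simp: components_def)
  then have "size (comp_sizes V E) = 1" by (simp add: size_comp_sizes)
  then have "card E + 1 = card V" using forest_size_comp_sizes[of E] by simp
  moreover have "card E = card L + card inner_edges"
    unfolding edge_cases using leaf_inner_disjoint[of L]
    by (subst card_Un_disjoint) (auto simp: card_leaf_edges, simp add: leaf_edges_def)
  ultimately show ?thesis using card_split by simp
qed

text \<open>
  With all skeleton edges present, removing a leaf edge leaves a leaf and one other component.
\<close>

lemma card_edge_sets_top: "card (edge_sets {#card V - 1#}) = card L"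
proof -
  let ?N = "{#card V - 1#}" and ?h = "\<lambda>l. leaf_edges (L - {l}) \<union> inner_edges"
  have N: "1 \<notin># ?N" using card_V by auto
  have "edge_sets ?N = ?h ` L"
  proof
    show "edge_sets ?N \<subseteq> ?h ` L"
    proof
      fix S assume "S \<in> edge_sets ?N"
      then have S: "S \<subseteq> E" "comp_sizes V S = add_mset 1 ?N" by auto
      obtain l where l: "l \<in> L" "S = leaf_edges (L - {l}) \<union> (S \<inter> inner_edges)"
        using unique_missing_leaf[OF S N] .
      have "card (S \<inter> inner_edges) = card inner_edges"
        using size_removed[OF S l] card_inner_edges by simp
      then have "S \<inter> inner_edges = inner_edges" by (intro card_subset_eq) auto
      then show "S \<in> ?h ` L" using l by auto
    qed
    show "?h ` L \<subseteq> edge_sets ?N"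
    proof
      fix S assume "S \<in> ?h ` L"
      then obtain l where l: "l \<in> L" "S = ?h l" by blast
      have S: "S \<subseteq> E" using l edge_cases leaf_edges_subset[of "L - {l}"] by auto
      have "{l} \<in> components V S"
      proof (rule singleton_component)
        show "l \<in> V" using l leaves_subset by blast
        fix y show "{l, y} \<notin> S"
        proof
          assume "{l, y} \<in> S"
          moreover from this have "y = par l" using S edge_of_leaf_iff[OF l(1), of y] by blast
          ultimately have "{l, par l} \<in> S" by simp
          then show False using l leaf_edge_inj by (auto simp: leaf_edges_def inner_edges_def)
        qed
      qed
      then have "1 \<in># comp_sizes V S"
        unfolding comp_sizes_def by (auto intro!: image_eqI[of _ _ "{l}"])
      then obtain W where W: "comp_sizes V S = add_mset 1 W" by (auto dest: multi_member_split)
      have "size (comp_sizes V S) = 2"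
        using forest_size_comp_sizes[OF S] card_leaf_union[OF l(1) order_refl] card_inner_edges card_split
        by (simp add: l(2))
      then obtain a where "W = {#a#}" using W size_1_singleton_mset[of W] by auto
      then show "S \<in> edge_sets ?N" using sum_comp_sizes[OF S] S W by auto
    qed
  qed
  moreover have "inj_on ?h L"
  proof (rule inj_onI)
    fix l l' assume "l \<in> L" "l' \<in> L" "?h l = ?h l'"
    then show "l = l'" using inj_onD[OF inj_leaf_removal, of "(l, inner_edges)" "(l', inner_edges)"] by simp
  qed
  ultimately show ?thesis by (simp add: card_image)
qed

text \<open>
  All edge sets counted by one coefficient have the same sign.
\<close>

lemma lookup_Phi_tree:
  assumes "1 \<notin># N"
  shows "Poly_Mapping.lookup (Phi T) (mono_of_mset N)
    = (-1) ^ (card V - 1 - size N) * of_nat (card (edge_sets N))"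
proof -
  have "card S = card V - 1 - size N" if "S \<in> edge_sets N" for S
    using forest_size_comp_sizes[of S] that by auto
  then show ?thesis using assms by (simp add: lookup_Phi[OF pair_graph_T])
qed

lemma size_weights [simp]: "size weights = card C"
  by (simp add: weights_def)

lemma sum_weights: "sum_mset weights = card V"
proof -
  have "sum_mset weights = (\<Sum>c\<in>C. w c)" by (simp add: weights_def sum_unfold_sum_mset)
  also have "\<dots> = card C + (\<Sum>c\<in>C. card {l \<in> L. par l = c})"
    unfolding weight_eq sum.distrib by simp
  also have "(\<Sum>c\<in>C. card {l \<in> L. par l = c}) = card L"
    unfolding card_eq_sum using par_in_C finite_V by (intro sum.group) auto
  finally show ?thesis using card_split by simp
qed

lemma weights_ge_2: "x \<in># weights \<Longrightarrow> x \<ge> 2"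
  using weight_ge_2 finite_V by (auto simp: weights_def)

lemma weight_pairs_subset:
  assumes "p \<in># weight_pairs" shows "size p = 2 \<and> p \<subseteq># weights"
proof -
  obtain e where e: "e \<in> inner_edges" "p = edge_weights e" using assms by (auto simp: weight_pairs_def)
  obtain u v where "u \<noteq> v" "e = {u, v}" using e(1) by (rule inner_edgeE)
  then show ?thesis using edge_weights_subset[OF e(1)] e(2) by (simp add: edge_weights_def)
qed

lemma L_nonempty: "L \<noteq> {}"
proof -
  have "C \<noteq> {}" using card_inner_edges by (metis add_is_0 card.empty one_neq_zero)
  then show ?thesis using hanging_leaf by blast
qed

end

lemma size_mem_leaf_removals: "N \<in># leaf_removals M \<Longrightarrow> size N = size M"
  by (auto simp: mem_leaf_removals) (metis size_Suc_Diff1)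

lemma size_mem_contraction_removals:
  assumes "N \<in># contraction_removals M p" "p \<subseteq># M" "size p = 2"
  shows "size N + 1 = size M"
proof -
  have "size (M - p) + 2 = size M" using assms size_mset_mono[of p M] by (simp add: size_Diff_submset)
  moreover have "size (M - p - {#x#}) + 1 = size (M - p)" if "x \<in># M - p" for x
    using that by (metis Suc_eq_plus1 size_Suc_Diff1)
  ultimately show ?thesis using assms(1) unfolding mem_contraction_removals by fastforce
qed

text \<open>
  The coefficient of \<open>p_(n-1)\<close> is nonzero, which forces both trees to have the same order
  \<open>n\<close>; its absolute value is the number of leaves. From then on the signs agree, and equal coefficients
  mean equal numbers of edge sets.
\<close>

lemma skeleton_data_from_Phi:
  assumes T: "proper_tree T" and T': "proper_tree T'" and Phi: "Phi T = Phi T'"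
  shows "proper_tree_graph.weights T = proper_tree_graph.weights T'"
    and "proper_tree_graph.weight_pairs T = proper_tree_graph.weight_pairs T'"
proof -
  interpret A: proper_tree_graph T by unfold_locales fact
  interpret B: proper_tree_graph T' by unfold_locales fact
  let ?N = "{#card A.V - 1#}"
  have N: "1 \<notin># ?N" using A.card_V by auto
  have "Poly_Mapping.lookup (Phi T) (mono_of_mset ?N) \<noteq> 0"
    unfolding A.lookup_Phi_tree[OF N] A.card_edge_sets_top using A.L_nonempty by simp
  then have "B.edge_sets ?N \<noteq> {}"
    unfolding Phi B.lookup_Phi_tree[OF N] by (metis card.empty mult_zero_right of_nat_0)
  then obtain S where "S \<subseteq> B.E" "comp_sizes B.V S = add_mset 1 ?N" by blast
  then have n: "card A.V = card B.V" using B.sum_comp_sizes[of S] A.card_V by simp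
  have cards: "card (A.edge_sets N) = card (B.edge_sets N)" if "1 \<notin># N" for N
    using A.lookup_Phi_tree[OF that] B.lookup_Phi_tree[OF that] by (simp add: Phi n)
  have "card A.L = card B.L"
    using A.card_edge_sets_top B.card_edge_sets_top cards[OF N] n by simp
  then have k: "card A.C = card B.C" using A.card_split B.card_split n by simp
  have "filter_mset (\<lambda>N. 1 \<notin># N) (leaf_removals A.weights)
      = filter_mset (\<lambda>N. 1 \<notin># N) (leaf_removals B.weights)"
  proof (rule multiset_eqI)
    fix N
    show "count (filter_mset (\<lambda>N. 1 \<notin># N) (leaf_removals A.weights)) N
      = count (filter_mset (\<lambda>N. 1 \<notin># N) (leaf_removals B.weights)) N"
    proof (cases "size N = card A.C")
      case True
      then show ?thesis
        using cards[of N] A.card_edge_sets_leaf_removals[of N] B.card_edge_sets_leaf_removals[of N] k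
        by simp
    next
      case False
      then have "N \<notin># leaf_removals A.weights" "N \<notin># leaf_removals B.weights"
        using size_mem_leaf_removals k by fastforce+
      then show ?thesis by (simp add: not_in_iff)
    qed
  qed
  then show W: "A.weights = B.weights"
    using A.weights_ge_2 B.weights_ge_2 k n A.sum_weights B.sum_weights
    by (intro weights_from_leaf_removals) auto
  have "filter_mset (\<lambda>N. 1 \<notin># N) (\<Sum>p\<in>#A.weight_pairs. contraction_removals A.weights p)
      = filter_mset (\<lambda>N. 1 \<notin># N) (\<Sum>p\<in>#B.weight_pairs. contraction_removals A.weights p)"
  proof (rule multiset_eqI)
    fix N
    show "count (filter_mset (\<lambda>N. 1 \<notin># N) (\<Sum>p\<in>#A.weight_pairs. contraction_removals A.weights p)) N
      = count (filter_mset (\<lambda>N. 1 \<notin># N) (\<Sum>p\<in>#B.weight_pairs. contraction_removals A.weights p)) N"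
    proof (cases "size N + 1 = card A.C")
      case True
      then show ?thesis
        using cards[of N] A.card_edge_sets_contraction_removals[of N]
          B.card_edge_sets_contraction_removals[of N] k W by simp
    next
      case False
      then have "N \<notin># contraction_removals A.weights p" if "p \<in># A.weight_pairs + B.weight_pairs" for p
        using size_mem_contraction_removals[of N A.weights p] A.weight_pairs_subset B.weight_pairs_subset that W k
        by auto
      then have "count (\<Sum>p\<in>#A.weight_pairs. contraction_removals A.weights p) N = 0"
        "count (\<Sum>p\<in>#B.weight_pairs. contraction_removals A.weights p) N = 0"
        unfolding count_eq_zero_iff by (auto simp: mem_sum_mset)
      then show ?thesis by simp
    qed
  qed
  note contractions = this
  have sub: "size p = 2 \<and> p \<subseteq># A.weights" if "p \<in># A.weight_pairs + B.weight_pairs" for p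
    using that A.weight_pairs_subset[of p] B.weight_pairs_subset[of p] W by auto
  show "A.weight_pairs = B.weight_pairs"
    by (rule pairs_from_contraction_removals[OF A.weights_ge_2 sub contractions])
qed

section \<open>Reconstruction of the tree\<close>

lemma bij_of_equal_colour_counts:
  assumes "finite A" "finite B" "image_mset f (mset_set A) = image_mset g (mset_set B)"
  obtains h where "bij_betw h A B" "\<And>a. a \<in> A \<Longrightarrow> g (h a) = f a"
proof -
  have "\<exists>h. bij_betw h A B \<and> (\<forall>a\<in>A. g (h a) = f a)"
    using assms
  proof (induction A arbitrary: B rule: finite_induct)
    case empty
    then show ?case by (auto simp: mset_set_empty_iff bij_betw_def)
  next
    case (insert a A)
    have "f a \<in># image_mset g (mset_set B)" using insert.prems(2)[symmetric] insert.hyps by simp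
    then obtain b where b: "b \<in> B" "g b = f a" using insert.prems(1) by auto
    have "mset_set B = add_mset b (mset_set (B - {b}))"
      using b insert.prems(1) by (simp add: mset_set.remove)
    then have "image_mset f (mset_set A) = image_mset g (mset_set (B - {b}))"
      using insert b by simp
    then obtain h where h: "bij_betw h A (B - {b})" "\<forall>x\<in>A. g (h x) = f x"
      using insert.IH[of "B - {b}"] insert.prems(1) by auto
    have "bij_betw (h(a := b)) (insert a A) (insert b (B - {b}))"
      using h(1) insert.hyps by (auto simp: bij_betw_def inj_on_def)
    moreover have "insert b (B - {b}) = B" using b by auto
    ultimately have "bij_betw (h(a := b)) (insert a A) B" by simp
    moreover have "\<forall>x\<in>insert a A. g ((h(a := b)) x) = f x" using h(2) b by simp
    ultimately show ?case by blast
  qed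
  then show ?thesis using that by blast
qed

context proper_tree_graph
begin

definition incident :: "'a \<Rightarrow> 'a set set" where
  "incident c = {e \<in> inner_edges. c \<in> e}"

lemma finite_incident [simp]: "finite (incident c)"
  by (simp add: incident_def)

lemma count_weights: "count weights a = card {c \<in> C. w c = a}"
  unfolding weights_def using finite_V by (intro count_image_mset_set) simp

lemma unique_weight:
  assumes "count weights (w c) \<le> 1" "c \<in> C" "d \<in> C" "w d = w c"
  shows "d = c"
proof -
  have "finite {x \<in> C. w x = w c}" using finite_V by simp
  then have "x = y" if "x \<in> {x \<in> C. w x = w c}" "y \<in> {x \<in> C. w x = w c}" for x y
    using assms(1) that unfolding count_weights by (simp add: card_le_Suc0_iff_eq)
  then show ?thesis using assms by blast
qed

text \<open>
  Count pairs of an edge and an end of weight \<open>a\<close> in two ways. The right-hand side depends only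
  on the pairs of adjacent weights.
\<close>

lemma sum_incident:
  "(\<Sum>c | c \<in> C \<and> w c = a. card {e \<in> incident c. Q (edge_weights e)})
    = (\<Sum>p\<in>#filter_mset Q weight_pairs. count p a)"
proof -
  let ?I = "{e \<in> inner_edges. Q (edge_weights e)}"
  have "(\<Sum>c | c \<in> C \<and> w c = a. card {e \<in> incident c. Q (edge_weights e)})
    = (\<Sum>c | c \<in> C \<and> w c = a. \<Sum>e | e \<in> ?I \<and> c \<in> e. 1)"
    by (intro sum.cong refl) (auto simp: incident_def intro!: arg_cong[of _ _ card])
  also have "\<dots> = (\<Sum>e\<in>?I. \<Sum>c | c \<in> {c. c \<in> C \<and> w c = a} \<and> c \<in> e. 1)"
    using finite_V by (intro sum.swap_restrict) auto
  also have "\<dots> = (\<Sum>e\<in>?I. count (edge_weights e) a)"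
  proof (rule sum.cong[OF refl])
    fix e assume "e \<in> ?I"
    then have e: "e \<subseteq> C" by (auto simp: inner_edges_def)
    then have "finite e" using finite_V by (meson finite_Diff finite_subset)
    moreover have "{c. c \<in> {c. c \<in> C \<and> w c = a} \<and> c \<in> e} = {c \<in> e. w c = a}" using e by auto
    ultimately show "(\<Sum>c | c \<in> {c. c \<in> C \<and> w c = a} \<and> c \<in> e. 1) = count (edge_weights e) a"
      by (simp add: edge_weights_def count_image_mset_set)
  qed
  also have "\<dots> = (\<Sum>p\<in>#image_mset edge_weights (mset_set ?I). count p a)"
    by (rule sum_image_mset_set)
  also have "image_mset edge_weights (mset_set ?I) = filter_mset Q weight_pairs"
    by (simp add: weight_pairs_def filter_mset_image_mset filter_mset_mset_set)
  finally show ?thesis .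
qed

text \<open>
  The skeleton is connected: membership of the hub in \<open>D\<close> is constant along all edges of the
  tree.
\<close>

lemma closed_under_inner_edges:
  assumes "D \<subseteq> C" "D \<noteq> {}"
    and closed: "\<And>u v. {u, v} \<in> inner_edges \<Longrightarrow> u \<in> D \<Longrightarrow> v \<in> D"
  shows "D = C"
proof -
  obtain d where d: "d \<in> D" using assms(2) by blast
  have "c \<in> D" if c: "c \<in> C" for c
  proof -
    have "(d, c) \<in> linked E" using connected d c assms(1) by blast
    then have "(hub L d \<in> D) = (hub L c \<in> D)"
    proof (rule linked_invariant)
      fix u v assume uv: "{u, v} \<in> E"
      then consider "{u, v} \<in> leaf_edges L" | "{u, v} \<in> inner_edges" using edge_cases by auto
      then show "(hub L u \<in> D) = (hub L v \<in> D)"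
      proof cases
        case 1
        then have "hub L u = hub L v"
          using linked_edge[of u v "leaf_edges L"] linked_leaf_edges[of L u v] by simp
        then show ?thesis by simp
      next
        case 2
        then have "u \<notin> L" "v \<notin> L" "{v, u} \<in> inner_edges" by (auto simp: inner_edges_def insert_commute)
        then show ?thesis using 2 closed by (auto simp: hub_def)
      qed
    qed
    moreover have "hub L d = d" "hub L c = c" using c d assms(1) by (auto simp: hub_def)
    ultimately show ?thesis using d by simp
  qed
  then show ?thesis using assms(1) by blast
qed

lemma incident_nonempty:
  assumes "c \<in> C" "card C \<ge> 2" shows "card (incident c) \<ge> 1"
proof (rule ccontr)
  assume "\<not> card (incident c) \<ge> 1"
  then have "incident c = {}" by (simp add: card_eq_0_iff not_le)
  then have "{c} = C" using assms(1) by (intro closed_under_inner_edges) (auto simp: incident_def)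
  then have "card C = 1" by (metis is_singletonI is_singleton_altdef)
  then show False using assms(2) by simp
qed

text \<open>
  Multiplicity isolation, expressed by the number of incident skeleton edges.
\<close>

definition repeats_at_leaves :: bool where
  "repeats_at_leaves \<longleftrightarrow> (\<forall>c\<in>C. count weights (w c) > 1 \<longrightarrow> card (incident c) = 1)"

lemma multiplicity_isolated_repeats_at_leaves:
  assumes "multiplicity_isolated (weighted_skeleton T)"
  shows repeats_at_leaves
  unfolding repeats_at_leaves_def
proof (intro ballI impI)
  fix c assume c: "c \<in> C" and "count weights (w c) > 1"
  then have "c \<in> leaves (skeleton T)"
    using assms by (auto simp: weighted_skeleton_def count_weights skeleton_def)
  then have "card {u. (c, u) \<in> parcs (skeleton T)} = 1" by (simp add: leaves_def out_degree_with_proj)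
  also have "{u. (c, u) \<in> parcs (skeleton T)} = {u. {c, u} \<in> inner_edges}"
    using edge_in_V by (auto simp: skeleton_def inner_edges_def arc_iff_edge)
  also have "card \<dots> = card (incident c)"
  proof (rule bij_betw_same_card[of "\<lambda>u. {c, u}"], rule bij_betw_imageI)
    show "inj_on (\<lambda>u. {c, u}) {u. {c, u} \<in> inner_edges}"
      by (auto simp: inj_on_def doubleton_eq_iff)
    show "(\<lambda>u. {c, u}) ` {u. {c, u} \<in> inner_edges} = incident c"
    proof
      show "incident c \<subseteq> (\<lambda>u. {c, u}) ` {u. {c, u} \<in> inner_edges}"
      proof
        fix e assume e: "e \<in> incident c"
        then have "e \<in> inner_edges" "c \<in> e" by (auto simp: incident_def)
        then obtain u where "e = {c, u}" by (auto elim!: inner_edgeE)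
        then show "e \<in> (\<lambda>u. {c, u}) ` {u. {c, u} \<in> inner_edges}" using \<open>e \<in> inner_edges\<close> by blast
      qed
    qed (auto simp: incident_def)
  qed
  finally show "card (incident c) = 1" .
qed

text \<open>
  Two adjacent vertices of degree one make up the whole skeleton. Hence in larger skeletons a
  vertex of repeated weight has a neighbour of unique weight.
\<close>

lemma adjacent_repeats:
  assumes r: repeats_at_leaves and uv: "{u, v} \<in> inner_edges"
    and multi: "count weights (w u) > 1" "count weights (w v) > 1"
  shows "C = {u, v}"
proof -
  have C: "u \<in> C" "v \<in> C" using uv by (auto simp: inner_edges_def)
  have "incident x = {{u, v}}" if "x \<in> {u, v}" for x
  proof -
    have "card (incident x) = 1" using that r multi C by (auto simp: repeats_at_leaves_def)
    moreover have "{u, v} \<in> incident x" using that uv by (auto simp: incident_def)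
    ultimately show ?thesis by (metis card_1_singletonE singletonD)
  qed
  then have inc: "e = {u, v}" if "e \<in> inner_edges" "x \<in> e" "x \<in> {u, v}" for e x
    using that unfolding incident_def by blast
  have "{u, v} = C"
  proof (rule closed_under_inner_edges)
    show "y \<in> {u, v}" if "{x, y} \<in> inner_edges" "x \<in> {u, v}" for x y
      using inc[of "{x, y}" x] that by blast
  qed (use C in auto)
  then show ?thesis ..
qed

text \<open>
  A vertex of unique weight is identified by its weight alone. For a repeated weight the weight pair
  of the incident edge is recorded too, as a multiset with one element when the vertex is a
  leaf of the skeleton.
\<close>

definition colour :: "'a \<Rightarrow> nat \<times> nat multiset multiset" where
  "colour c = (w c, if count weights (w c) > 1
     then image_mset edge_weights (mset_set (incident c)) else {#})"

text \<open>
  The right-hand side contains only the weights and the pairs of adjacent weights, so two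
  trees that share these data have equally many vertices of each colour.
\<close>

lemma count_colour:
  assumes r: repeats_at_leaves
  shows "card {c \<in> C. colour c = (a, Z)} =
    (if count weights a > 1 then
       (if size Z = 1 then (\<Sum>p\<in>#filter_mset (\<lambda>p. Z = {#p#}) weight_pairs. count p a) else 0)
     else if Z = {#} then count weights a else 0)"
proof (cases "count weights a > 1")
  case True
  then have inc: "card (incident c) = 1" if "c \<in> C" "w c = a" for c
    using that r by (auto simp: repeats_at_leaves_def)
  have "(colour c = (a, Z)) = (size Z = 1 \<and> card {e \<in> incident c. Z = {#edge_weights e#}} = 1)"
    "card {e \<in> incident c. Z = {#edge_weights e#}} \<le> 1" if "c \<in> C" "w c = a" for c
  proof -
    have "card (incident c) = 1" using that by (rule inc)
    then obtain e where e: "incident c = {e}" by (rule card_1_singletonE)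
    then have "{e' \<in> incident c. Z = {#edge_weights e'#}} = (if Z = {#edge_weights e#} then {e} else {})"
      by auto
    then show "(colour c = (a, Z)) = (size Z = 1 \<and> card {e \<in> incident c. Z = {#edge_weights e#}} = 1)"
      "card {e \<in> incident c. Z = {#edge_weights e#}} \<le> 1"
      using that True e by (auto simp: colour_def)
  qed
  note col = this
  show ?thesis
  proof (cases "size Z = 1")
    case s: True
    have "{c \<in> C. colour c = (a, Z)} = {c \<in> {c \<in> C. w c = a}. colour c = (a, Z)}"
      by (auto simp: colour_def)
    then have "card {c \<in> C. colour c = (a, Z)}
        = (\<Sum>c | c \<in> C \<and> w c = a. if colour c = (a, Z) then 1 else 0)"
      using finite_V by (simp add: sum.If_cases Int_def)
    also have "\<dots> = (\<Sum>c | c \<in> C \<and> w c = a. card {e \<in> incident c. Z = {#edge_weights e#}})"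
      using col s by (intro sum.cong refl) (force simp: le_Suc_eq)
    also have "\<dots> = (\<Sum>p\<in>#filter_mset (\<lambda>p. Z = {#p#}) weight_pairs. count p a)"
      by (rule sum_incident[where Q = "\<lambda>p. Z = {#p#}"])
    finally show ?thesis using True s by simp
  next
    case False
    then have "{c \<in> C. colour c = (a, Z)} = {}" using col by (force simp: colour_def)
    then show ?thesis using True False by simp
  qed
next
  case False
  then have "{c \<in> C. colour c = (a, Z)} = (if Z = {#} then {c \<in> C. w c = a} else {})"
    by (auto simp: colour_def)
  then show ?thesis using False by (simp add: count_weights)
qed

end

text \<open>
  Two proper trees with the same weights and the same pairs of adjacent weights.
\<close>

locale two_proper_trees = A: proper_tree_graph T + B: proper_tree_graph T'
  for T :: "'a pair_pre_digraph" and T' :: "'b pair_pre_digraph" +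
  assumes weights_eq: "A.weights = B.weights"
    and pairs_eq: "A.weight_pairs = B.weight_pairs"
begin

lemma card_C_eq: "card A.C = card B.C"
  using arg_cong[OF weights_eq, of size] by simp

text \<open>
  For a repeated weight \<open>a\<close> the degrees of the vertices of weight \<open>a\<close> have the same sum in
  both trees. In the first tree it is the number of these vertices, and in the second tree each
  summand is at least one.
\<close>

lemma repeats_at_leaves_transfer:
  assumes "A.repeats_at_leaves" shows "B.repeats_at_leaves"
  unfolding B.repeats_at_leaves_def
proof (intro ballI impI)
  fix c assume c: "c \<in> B.C" and multi: "count B.weights (B.w c) > 1"
  let ?a = "B.w c"
  let ?A = "{x. x \<in> A.C \<and> A.w x = ?a}" and ?B = "{x. x \<in> B.C \<and> B.w x = ?a}"
  have fin: "finite ?B" using B.finite_V by simp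
  have "card ?B \<le> card B.C" using B.finite_V by (intro card_mono) auto
  then have two: "card B.C \<ge> 2" using multi by (simp add: B.count_weights)
  have "(\<Sum>x\<in>?B. card (B.incident x)) = (\<Sum>x\<in>?A. card (A.incident x))"
    using A.sum_incident[where a = ?a and Q = "\<lambda>_. True"] B.sum_incident[where a = ?a and Q = "\<lambda>_. True"] by (simp add: pairs_eq)
  also have "\<dots> = card ?A"
    using assms multi weights_eq by (simp add: A.repeats_at_leaves_def)
  also have "\<dots> = (\<Sum>x\<in>?B. 1)"
    using weights_eq A.count_weights[of ?a] B.count_weights[of ?a] by simp
  finally have eq: "(\<Sum>x\<in>?B. card (B.incident x)) = (\<Sum>x\<in>?B. 1)" .
  have ge: "1 \<le> card (B.incident x)" if "x \<in> ?B" for x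
    using that B.incident_nonempty two by blast
  show "card (B.incident c) = 1"
  proof (rule ccontr)
    assume "card (B.incident c) \<noteq> 1"
    then have "1 < card (B.incident c)" using ge[of c] c by simp
    then have "(\<Sum>x\<in>?B. 1) < (\<Sum>x\<in>?B. card (B.incident x))"
      using fin ge c by (intro sum_strict_mono_ex1) auto
    then show False using eq by simp
  qed
qed

text \<open>
  Unless the skeleton is a single edge, one end \<open>y\<close> of every skeleton edge has a unique weight.
  The other end \<open>x\<close> is either unique too, so that the pair of weights determines the
  edge, or its colour records the weight of \<open>y\<close>.
\<close>

lemma inner_edge_transfer:
  assumes r: "A.repeats_at_leaves" and f: "bij_betw f A.C B.C"
    and col: "\<And>c. c \<in> A.C \<Longrightarrow> B.colour (f c) = A.colour c"
    and uv: "{u, v} \<in> A.inner_edges"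
  shows "{f u, f v} \<in> B.inner_edges"
proof -
  have C: "u \<in> A.C" "v \<in> A.C" and neq: "u \<noteq> v"
    using uv A.edge_neq by (auto simp: A.inner_edges_def)
  have fC: "f c \<in> B.C" and fw: "B.w (f c) = A.w c" if "c \<in> A.C" for c
    using that f col[OF that] by (auto simp: bij_betw_def A.colour_def B.colour_def)
  have edge: "{f x, f y} \<in> B.inner_edges"
    if xy: "{x, y} \<in> A.inner_edges" "x \<in> A.C" "y \<in> A.C" "x \<noteq> y" "\<not> count A.weights (A.w y) > 1" for x y
  proof -
    have pair: "A.edge_weights {x, y} = {#A.w x, A.w y#}" using xy by (simp add: A.edge_weights_def)
    have y: "z = f y" if "z \<in> B.C" "B.w z = A.w y" for z
    proof (rule B.unique_weight)
      show "count B.weights (B.w (f y)) \<le> 1" using xy(5) fw[OF xy(3)] weights_eq by simp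
      show "f y \<in> B.C" by (rule fC[OF xy(3)])
    qed (use that fw[OF xy(3)] in simp_all)
    obtain e where e: "e \<in> B.inner_edges" "B.edge_weights e = {#A.w x, A.w y#}" "f x \<in> e"
    proof (cases "count A.weights (A.w x) > 1")
      case True
      have "{x, y} \<in> A.incident x" using xy by (simp add: A.incident_def)
      then have "A.edge_weights {x, y} \<in># image_mset B.edge_weights (mset_set (B.incident (f x)))"
        using col[OF xy(2)] True weights_eq by (auto simp: A.colour_def B.colour_def fw[OF xy(2)])
      then show ?thesis using that pair by (auto simp: B.incident_def)
    next
      case False
      have x: "z = f x" if "z \<in> B.C" "B.w z = A.w x" for z
      proof (rule B.unique_weight)
        show "count B.weights (B.w (f x)) \<le> 1" using False fw[OF xy(2)] weights_eq by simp
        show "f x \<in> B.C" by (rule fC[OF xy(2)])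
      qed (use that fw[OF xy(2)] in simp_all)
      have "A.edge_weights {x, y} \<in># B.weight_pairs"
        using xy by (simp add: A.weight_pairs_def flip: pairs_eq)
      then obtain e where e: "e \<in> B.inner_edges" "B.edge_weights e = {#A.w x, A.w y#}"
        using pair by (auto simp: B.weight_pairs_def)
      then have "A.w x \<in># B.edge_weights e" by simp
      then obtain z where "z \<in> e" "B.w z = A.w x"
        by (metis B.edge_weights_def imageE set_image_mset finite_set_mset_mset_set mset_set.infinite set_mset_empty empty_iff)
      then show ?thesis using that[OF e] x[of z] e(1) by (auto simp: B.inner_edges_def)
    qed
    obtain s t where st: "s \<in> B.C" "t \<in> B.C" "s \<noteq> t" "e = {s, t}" using e(1) by (rule B.inner_edgeE)
    obtain z where z: "z \<in> B.C" "f x \<noteq> z" "e = {f x, z}"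
    proof (cases "f x = s")
      case True
      then show ?thesis using that[of t] st by simp
    next
      case False
      then have "f x = t" using st e(3) by simp
      then show ?thesis using that[of s] st by (simp add: insert_commute)
    qed
    then have "{#B.w (f x), B.w z#} = {#A.w x, A.w y#}" using e(2) by (simp add: B.edge_weights_def)
    then have "B.w z = A.w y" using fw[OF xy(2)] by simp
    then show ?thesis using y z e by simp
  qed
  consider "\<not> count A.weights (A.w v) > 1" | "\<not> count A.weights (A.w u) > 1"
    | "count A.weights (A.w u) > 1" "count A.weights (A.w v) > 1" by blast
  then show ?thesis
  proof cases
    case 1
    then show ?thesis using edge[of u v] uv C neq by blast
  next
    case 2
    then show ?thesis using edge[of v u] uv C neq by (simp add: insert_commute)
  next
    case 3
    then have "A.C = {u, v}" using A.adjacent_repeats[OF r uv] by blast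
    then have BC: "B.C = {f u, f v}" "card B.C = 2" using f neq card_C_eq by (auto simp: bij_betw_def)
    then have "card B.inner_edges = 1" using B.card_inner_edges by simp
    then obtain e where e: "e \<in> B.inner_edges" by (metis card_1_singletonE singletonI)
    then obtain s t where st: "s \<in> B.C" "t \<in> B.C" "s \<noteq> t" "e = {s, t}" by (rule B.inner_edgeE)
    then have "e = B.C" using BC by (intro card_subset_eq) auto
    then show ?thesis using e BC by simp
  qed
qed

end

lemma digraph_isoI:
  assumes G: "pair_graph G" and f: "bij_betw f (pverts G) (pverts H)"
    and H: "parcs H \<subseteq> pverts H \<times> pverts H"
    and arc: "\<And>u v. u \<in> pverts G \<Longrightarrow> v \<in> pverts G \<Longrightarrow> (u, v) \<in> parcs G \<longleftrightarrow> (f u, f v) \<in> parcs H"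
  shows "digraph_iso (with_proj G) (with_proj H)"
proof -
  interpret pair_graph G by fact
  let ?h = "\<lparr>iso_verts = f, iso_arcs = map_prod f f, iso_head = snd, iso_tail = fst\<rparr>"
  have inj: "inj_on f (pverts G)" using f by (rule bij_betw_imp_inj_on)
  have "inj_on (map_prod f f) (parcs G)"
    using inj wellformed' by (auto simp: inj_on_def)
  then have 1: "digraph_isomorphism ?h"
    unfolding digraph_isomorphism_def using inj wf_digraph by auto
  have "map_prod f f ` parcs G = parcs H"
  proof (intro equalityI subsetI)
    fix a assume "a \<in> map_prod f f ` parcs G"
    then obtain x y where "(x, y) \<in> parcs G" "a = (f x, f y)" by auto
    then show "a \<in> parcs H" using arc[of x y] wellformed'[of x y] by blast
  next
    fix a assume a: "a \<in> parcs H"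
    then have "fst a \<in> f ` pverts G" "snd a \<in> f ` pverts G"
      using H f by (auto simp: bij_betw_def)
    then obtain x y where "a = (f x, f y)" "x \<in> pverts G" "y \<in> pverts G"
      by (metis imageE prod.collapse)
    then show "a \<in> map_prod f f ` parcs G" using arc[of x y] a by force
  qed
  then have "with_proj H = app_iso ?h (with_proj G)"
    using f by (simp add: app_iso_def with_proj_def bij_betw_def)
  then show ?thesis using 1 by (auto simp: digraph_iso_def)
qed

text \<open>
  Match the non-leaves by colour, and then the leaves by the image of their neighbour.
\<close>

lemma (in two_proper_trees) isomorphic:
  assumes r: "A.repeats_at_leaves"
  shows "digraph_iso (with_proj T) (with_proj T')"
proof -
  \<comment> \<open>The exchanged trees are used to pull skeleton edges back.\<close>
  interpret S: two_proper_trees T' T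
    by unfold_locales (use weights_eq pairs_eq in simp_all)
  have r': "B.repeats_at_leaves" by (rule repeats_at_leaves_transfer[OF r])
  have "image_mset A.colour (mset_set A.C) = image_mset B.colour (mset_set B.C)"
  proof (rule multiset_eqI)
    fix x :: "nat \<times> nat multiset multiset"
    obtain a Z where x: "x = (a, Z)" by fastforce
    show "count (image_mset A.colour (mset_set A.C)) x = count (image_mset B.colour (mset_set B.C)) x"
      unfolding x count_image_mset_set[OF finite_Diff[OF A.finite_V]] count_image_mset_set[OF finite_Diff[OF B.finite_V]]
        A.count_colour[OF r] B.count_colour[OF r'] weights_eq pairs_eq ..
  qed
  then obtain f where f: "bij_betw f A.C B.C" and col: "\<And>c. c \<in> A.C \<Longrightarrow> B.colour (f c) = A.colour c"
    using bij_of_equal_colour_counts[of A.C B.C A.colour B.colour] A.finite_V B.finite_V by blast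
  have w: "B.w (f c) = A.w c" if "c \<in> A.C" for c
    using col[OF that] by (simp add: A.colour_def B.colour_def)
  define g where "g = the_inv_into A.C f"
  have g: "bij_betw g B.C A.C" unfolding g_def using f by (rule bij_betw_the_inv_into)
  have gf: "g (f c) = c" if "c \<in> A.C" for c
    unfolding g_def using f that by (simp add: bij_betw_def the_inv_into_f_f)
  have fg: "f (g c) = c" if "c \<in> B.C" for c
    unfolding g_def using f that by (simp add: bij_betw_def f_the_inv_into_f)
  have col': "A.colour (g c) = B.colour c" if "c \<in> B.C" for c
  proof -
    have "g c \<in> A.C" using g that unfolding bij_betw_def by blast
    then show ?thesis using col[of "g c"] fg[OF that] by simp
  qed
  have inner: "{u, v} \<in> A.inner_edges \<longleftrightarrow> {f u, f v} \<in> B.inner_edges" if "u \<in> A.C" "v \<in> A.C" for u v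
  proof
    show "{u, v} \<in> A.inner_edges \<Longrightarrow> {f u, f v} \<in> B.inner_edges"
      by (rule inner_edge_transfer[OF r f col])
    assume "{f u, f v} \<in> B.inner_edges"
    then have "{g (f u), g (f v)} \<in> A.inner_edges"
      by (rule S.inner_edge_transfer[OF r' g, rotated]) (rule col')
    then show "{u, v} \<in> A.inner_edges" using gf that by simp
  qed
  have "image_mset (\<lambda>l. f (A.par l)) (mset_set A.L) = image_mset B.par (mset_set B.L)"
  proof (rule multiset_eqI)
    fix y
    have "card {l \<in> A.L. f (A.par l) = y} = card {l \<in> B.L. B.par l = y}"
    proof (cases "y \<in> B.C")
      case True
      then have gy: "g y \<in> A.C" using g by (auto simp: bij_betw_def)
      have "{l \<in> A.L. f (A.par l) = y} = {l \<in> A.L. A.par l = g y}"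
        using gf fg[OF True] A.par_in_C by metis
      then show ?thesis using w[OF gy] fg[OF True] by (simp add: A.weight_eq B.weight_eq)
    next
      case False
      then have "{l \<in> A.L. f (A.par l) = y} = {}" "{l \<in> B.L. B.par l = y} = {}"
        using A.par_in_C B.par_in_C f unfolding bij_betw_def by blast+
      then show ?thesis by (simp only: card.empty)
    qed
    then show "count (image_mset (\<lambda>l. f (A.par l)) (mset_set A.L)) y = count (image_mset B.par (mset_set B.L)) y"
      by (simp add: count_image_mset_set)
  qed
  then obtain h where h: "bij_betw h A.L B.L" and par: "\<And>l. l \<in> A.L \<Longrightarrow> B.par (h l) = f (A.par l)"
    using bij_of_equal_colour_counts[of A.L B.L "\<lambda>l. f (A.par l)" B.par] by auto
  define F where "F x = (if x \<in> A.L then h x else f x)" for x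
  have "bij_betw F (A.L \<union> A.C) (B.L \<union> B.C)"
  proof (rule bij_betw_combine)
    show "bij_betw F A.L B.L" using h by (rule bij_betw_cong[THEN iffD1, rotated]) (simp add: F_def)
    show "bij_betw F A.C B.C" using f by (rule bij_betw_cong[THEN iffD1, rotated]) (simp add: F_def)
  qed auto
  moreover have "A.L \<union> A.C = A.V" "B.L \<union> B.C = B.V" using A.leaves_subset B.leaves_subset by auto
  ultimately have F: "bij_betw F A.V B.V" by simp
  have leaf: "{x, y} \<in> A.E \<longleftrightarrow> {F x, F y} \<in> B.E" if "x \<in> A.L" "y \<in> A.V" for x y
  proof -
    have "F x \<in> B.L" "B.par (F x) = F (A.par x)"
      using that h par A.par_in_C[of x] by (auto simp: F_def bij_betw_def)
    then have "{F x, F y} \<in> B.E \<longleftrightarrow> F y = F (A.par x)" by (simp add: B.edge_of_leaf_iff)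
    also have "\<dots> \<longleftrightarrow> y = A.par x"
      using F that A.par_in_C[of x] by (auto simp: bij_betw_def dest: inj_onD)
    finally show ?thesis using A.edge_of_leaf_iff[OF that(1)] by simp
  qed
  have "{x, y} \<in> A.E \<longleftrightarrow> {F x, F y} \<in> B.E" if xy: "x \<in> A.V" "y \<in> A.V" for x y
  proof -
    consider "x \<in> A.L" | "y \<in> A.L" | "x \<in> A.C" "y \<in> A.C" using xy by blast
    then show ?thesis
    proof cases
      case 1
      then show ?thesis using leaf xy by blast
    next
      case 2
      then show ?thesis using leaf[of y x] xy by (simp add: insert_commute)
    next
      case 3
      then have "{x, y} \<in> A.E \<longleftrightarrow> {x, y} \<in> A.inner_edges" by (simp add: A.inner_edges_def)
      moreover have "f x \<in> B.C" "f y \<in> B.C" using 3 f by (auto simp: bij_betw_def)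
      then have "{f x, f y} \<in> B.E \<longleftrightarrow> {f x, f y} \<in> B.inner_edges" by (simp add: B.inner_edges_def)
      moreover have "F x = f x" "F y = f y" using 3 by (auto simp: F_def)
      ultimately show ?thesis using inner 3 by simp
    qed
  qed
  then show ?thesis
    using F B.edge_in_V
    by (intro digraph_isoI[of _ F] A.pair_graph_T) (auto simp: A.arc_iff_edge B.arc_iff_edge)
qed

theorem theorem1:
  fixes T :: "'a pair_pre_digraph" and T' :: "'b pair_pre_digraph"
  assumes "proper_tree T"
    and "multiplicity_isolated (weighted_skeleton T)"
    and "proper_tree T'"
    and "Phi T = Phi T'"
  shows "digraph_iso (with_proj T) (with_proj T')"
proof -
  interpret two_proper_trees T T'
    by unfold_locales (use assms skeleton_data_from_Phi in auto)
  show ?thesis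
    using A.multiplicity_isolated_repeats_at_leaves[OF assms(2)] by (rule isomorphic)
qed

end
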